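(* Let $v$ be a finite place of $K$. Let $\Lambda_1,\ldots,\Lambda_d\in\mathrm{GL}_\nu(\mathbb{Q})$ be mutually commuting matrices all of whose eigenvalues are in $\mathbb{Q}\cap\mathbb{Z}_{p(v)}\setminus\mathbb{Z}$, and let $\underline\tau=(\tau_1,\ldots,\tau_d)$ with $\tau_1=\cdots=\tau_d=\tau\in K\setminus\{0\}$. Let $\mu\ge1$ be an integer and $Y(\underline x)=\sum_{\underline\alpha\in\mathbb{N}^d\cup(-\mathbb{N})^d}Y_{\underline\alpha}\underline x^{\underline\alpha}$ a $\mu\times\nu$ matrix with entries in $K[[\underline x,1/\underline x]]$. For $\underline\alpha\in\mathbb{N}^d\cup(-\mathbb{N})^d$ set $$Z^{\underline\tau}_{\underline\Lambda,\underline\alpha}=Y_{-\underline\alpha}\prod_{1\le i\le d}C_{\Lambda_i,\tau_i}(-\alpha_i).$$ Then, with $\underline\alpha$ running over $\mathbb{N}^d$, $$\limsup_{|\underline\alpha|\to+\infty}\|Z^{\underline\tau}_{\underline\Lambda,\underline\alpha}\|_v^{1/|\underline\alpha|}\le\pi_v^{-1}|\tau|_v\limsup_{|\underline\alpha|\to+\infty}\|Y_{-\underline\alpha}\|_v^{1/|\underline\alpha|},$$ and $$\limsup_{|\underline\alpha|\to+\infty}\|Z^{\underline\tau}_{\underline\Lambda,-\underline\alpha}\|_v^{1/|\underline\alpha|}\le\pi_v|\tau|_v^{-1}\limsup_{|\underline\alpha|\to+\infty}\|Y_{\underline\alpha}\|_v^{1/|\underline\alpha|}.$$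
   Context: $K$ is a number field, $d,\nu\ge1$, $\underline x=(x_1,\ldots,x_d)$, $|\underline\alpha|=\sum_i\alpha_i$ for $\underline\alpha\in\mathbb{N}^d$. For a finite place $v$ of $K$ above the prime $p(v)$, $|\cdot|_v$ is normalized by $|p(v)|_v=p(v)^{-1}$ and $\pi_v=|p(v)|_v^{1/(p(v)-1)}$. For a matrix $M$ with entries in $K$, $\|M\|_v$ is the maximum of the $v$-adic absolute values of its entries. $\mathbb{Q}\cap\mathbb{Z}_{p(v)}$ is the set of rationals with denominator prime to $p(v)$. For $\tau\in K\setminus\{0\}$ and a matrix $\Lambda\in\mathrm{GL}_\nu(K)$ with all eigenvalues in $K\setminus\mathbb{Z}$, and $\mathbb{I}_\nu$ the identity matrix, $C_{\Lambda,\tau}:\mathbb{Z}\to\mathrm{GL}_\nu(K)$ is defined by $C_{\Lambda,\tau}(n)=\tau^{-n}(\Lambda+n\mathbb{I}_\nu)(\Lambda+(n-1)\mathbb{I}_\nu)\cdots(\Lambda+\mathbb{I}_\nu)$ if $n\ge1$; $C_{\Lambda,\tau}(0)=\mathbb{I}_\nu$; $C_{\Lambda,\tau}(n)=\tau^{-n}\Lambda^{-1}(\Lambda-\mathbb{I}_\nu)^{-1}\cdots(\Lambda+(n+1)\mathbb{I}_\nu)^{-1}$ if $n\le-1$. (The $Z^{\underline\tau}_{\underline\Lambda,\underline\alpha}$ are the coefficients of the formal Laplace transform $\mathcal{L}^{\underline\tau}_{\underline\Lambda}(Y(\underline x)\,x_1^{\Lambda_1}\cdots x_d^{\Lambda_d})=\sum_{\underline\alpha}Y_{\underline\alpha}\prod_i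 C_{\Lambda_i,\tau_i}(\alpha_i)\,x_i^{-\Lambda_i-(\alpha_i+1)\mathbb{I}_\nu}$.) *)

theory Defs
  imports
    "HOL-Library.Extended_Real"
    "HOL-Computational_Algebra.Primes"
    "Jordan_Normal_Form.Char_Poly"
    "Jordan_Normal_Form.Gauss_Jordan_Elimination"
begin

text \<open>The type \<open>'k\<close> is a number field: a finite-dimensional vector space over the rationals.\<close>

definition number_field :: "'k::field_char_0 itself \<Rightarrow> bool" where
  "number_field _ \<longleftrightarrow>
     (\<exists>B. finite_dimensional_vector_space (\<lambda>(q::rat) (x::'k). of_rat q * x) B)"

text \<open>
  A place is a class of equivalent absolute values. The finite places above the prime \<open>p\<close> are
  represented by the unique ultrametric absolute value of the class that takes the value
  \<open>1/p\<close> at \<open>p\<close>.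
\<close>

definition finite_place_above :: "nat \<Rightarrow> ('k::field_char_0 \<Rightarrow> real) \<Rightarrow> bool" where
  "finite_place_above p v \<longleftrightarrow>
     prime p \<and>
     (\<forall>x. 0 \<le> v x) \<and>
     (\<forall>x. v x = 0 \<longleftrightarrow> x = 0) \<and>
     (\<forall>x y. v (x * y) = v x * v y) \<and>
     (\<forall>x y. v (x + y) \<le> max (v x) (v y)) \<and>
     v (of_nat p) = 1 / real p"

definition pi_place :: "nat \<Rightarrow> ('k::field_char_0 \<Rightarrow> real) \<Rightarrow> real" where
  "pi_place p v = v (of_nat p) powr (1 / (real p - 1))"

definition mat_norm :: "('k \<Rightarrow> real) \<Rightarrow> 'k mat \<Rightarrow> real" where
  "mat_norm v M = Max {v (M $$ (i, j)) | i j. i < dim_row M \<and> j < dim_col M}"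

definition p_integral_rats :: "nat \<Rightarrow> rat set" where
  "p_integral_rats p = {q. coprime (snd (quotient_of q)) (int p)}"

text \<open>
  An ordered product; the dimension fixes the value of the empty product. Matrices of different
  sizes share one type, so there is no monoid class to supply \<open>prod_list\<close>.
\<close>

definition mat_prod :: "nat \<Rightarrow> 'k::semiring_1 mat list \<Rightarrow> 'k mat" where
  "mat_prod n Ms = foldr (*) Ms (1\<^sub>m n)"

definition mat_inv :: "'k::field mat \<Rightarrow> 'k mat" where
  "mat_inv A = the (mat_inverse A)"

definition mat_shift :: "'k::field mat \<Rightarrow> int \<Rightarrow> 'k mat" where
  "mat_shift \<Lambda> k = \<Lambda> + of_int k \<cdot>\<^sub>m 1\<^sub>m (dim_row \<Lambda>)"

definition C_mat :: "'k::field mat \<Rightarrow> 'k \<Rightarrow> int \<Rightarrow> 'k mat" where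
  "C_mat \<Lambda> \<tau> n =
     (if n \<ge> 1 then
        (\<tau> powi (- n)) \<cdot>\<^sub>m mat_prod (dim_row \<Lambda>) (map (mat_shift \<Lambda>) (rev [1..n]))
      else if n = 0 then 1\<^sub>m (dim_row \<Lambda>)
      else
        (\<tau> powi (- n)) \<cdot>\<^sub>m
          mat_prod (dim_row \<Lambda>) (map (\<lambda>k. mat_inv (mat_shift \<Lambda> k)) (rev [n + 1..0])))"

text \<open>Multi-indices are integer vectors of length \<open>d\<close>, with coordinates \<open>0, ..., d - 1\<close>.\<close>

definition nat_indices :: "nat \<Rightarrow> int vec set" where
  "nat_indices d = {\<alpha> \<in> carrier_vec d. \<forall>i<d. 0 \<le> \<alpha> $ i}"

definition neg_indices :: "nat \<Rightarrow> int vec set" where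
  "neg_indices d = {\<alpha> \<in> carrier_vec d. \<forall>i<d. \<alpha> $ i \<le> 0}"

definition abs_index :: "int vec \<Rightarrow> int" where
  "abs_index \<alpha> = (\<Sum>i<dim_vec \<alpha>. \<alpha> $ i)"

text \<open>The limit \<open>abs_index \<alpha> \<rightarrow> \<infinity>\<close> along multi-indices with natural number coordinates.\<close>

definition index_filter :: "nat \<Rightarrow> int vec filter" where
  "index_filter d = inf (filtercomap abs_index at_top) (principal (nat_indices d))"

definition growth :: "nat \<Rightarrow> ('k \<Rightarrow> real) \<Rightarrow> (int vec \<Rightarrow> 'k mat) \<Rightarrow> ereal" where
  "growth d v F =
     Limsup (index_filter d)
       (\<lambda>\<alpha>. ereal (mat_norm v (F \<alpha>) powr (1 / real_of_int (abs_index \<alpha>))))"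

definition Z_coeff ::
  "nat \<Rightarrow> nat \<Rightarrow> (nat \<Rightarrow> 'k::field) \<Rightarrow> (nat \<Rightarrow> 'k mat) \<Rightarrow> (int vec \<Rightarrow> 'k mat) \<Rightarrow> int vec \<Rightarrow> 'k mat" where
  "Z_coeff d \<nu> \<tau> \<Lambda> Y \<alpha> =
     Y (- \<alpha>) * mat_prod \<nu> (map (\<lambda>i. C_mat (\<Lambda> i) (\<tau> i) (- (\<alpha> $ i))) [0..<d])"

end

theory Submission
  imports
    Defs
    "Jordan_Normal_Form.Schur_Decomposition"
    "HOL-Real_Asymp.Real_Asymp"
begin

text \<open>
  For a single eigenvalue \<open>q\<close> in place of the matrix, the statement is about the factors
  \<open>(q + 1) \<dots> (q + n)\<close> and \<open>1 / (q (q - 1) \<dots> (q - n + 1))\<close>, which have the same \<open>p\<close>-adic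
  size as \<open>n!\<close> and \<open>1 / n!\<close> up to a factor of polynomial growth, and \<open>v (n!)\<close> is \<open>\<pi> ^ n\<close>
  up to such a factor by Legendre's formula (\<open>v_fact_ge\<close>, \<open>v_fact_le\<close>). The bound for the first
  product holds because a product of \<open>n\<close> consecutive integers is divisible by \<open>n!\<close>
  (\<open>v_prod_consecutive_le\<close>). For the second, all factors except the smallest contribute
  no less than \<open>(n - 1)!\<close> (\<open>v_prod_consecutive_ge\<close>), and the smallest one is only polynomially
  small because \<open>q\<close> is rational and not an integer (\<open>v_rat_add_int_ge\<close>).

  The matrices are not diagonalizable in general, but \<open>\<Prod> (\<Lambda> - q\<^sub>j) = 0\<close> for a finite list of
  eigenvalues (\<open>rational_eigenvalues_annihilate\<close>). Let \<open>W\<^sub>j\<close> be the product of the first \<open>j\<close> of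
  these factors and \<open>G n = (\<Lambda> + n) \<dots> (\<Lambda> + 1)\<close>. Writing
  \<open>\<Lambda> + n + 1 = (\<Lambda> - q\<^sub>j\<^sub>+\<^sub>1) + (q\<^sub>j\<^sub>+\<^sub>1 + n + 1)\<close> gives
  \<open>W\<^sub>j G (n + 1) = (q\<^sub>j\<^sub>+\<^sub>1 + n + 1) W\<^sub>j G n + W\<^sub>j\<^sub>+\<^sub>1 G n\<close>,
  a scalar recurrence for every entry, whose inhomogeneity is one step closer to the product that
  vanishes. Solving it by variation of constants (\<open>poly_growth_recurrence\<close>) preserves the rate
  \<open>\<pi>\<close> up to polynomial factors, because the scalar estimates hold over every interval. Descending
  from the full product to \<open>W\<^sub>0 = 1\<close> bounds \<open>G\<close>, and the inverses are treated in the same way.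
  As the norm of a matrix is submultiplicative at an ultrametric place, the factors for
  the \<open>d\<close> variables can be estimated separately; with one common \<open>\<tau>\<close> they combine to
  \<open>\<rho> ^ |\<alpha>|\<close> times a polynomial in \<open>|\<alpha>|\<close>, and the \<open>|\<alpha>|\<close>-th root removes the polynomial
  (\<open>growth_le_mult\<close>).
\<close>

section \<open>The absolute value of a finite place\<close>

locale padic_place =
  fixes p :: nat and v :: "'k::field_char_0 \<Rightarrow> real"
  assumes place: "finite_place_above p v"
begin

lemma prime_p: "prime p"
  and v_nonneg [simp]: "0 \<le> v x"
  and v_eq_0_iff [simp]: "v x = 0 \<longleftrightarrow> x = 0"
  and v_mult: "v (x * y) = v x * v y"
  and v_add_le_max: "v (x + y) \<le> max (v x) (v y)"
  and v_p: "v (of_nat p) = 1 / real p"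
  using place unfolding finite_place_above_def by auto

lemma p_gt_1: "1 < p"
  by (rule prime_gt_1_nat[OF prime_p])

lemma v_0 [simp]: "v 0 = 0"
  by simp

lemma v_pos: "x \<noteq> 0 \<Longrightarrow> 0 < v x"
  by (metis v_eq_0_iff v_nonneg less_eq_real_def)

lemma v_1 [simp]: "v 1 = 1"
proof -
  have "v 1 * v 1 = v 1 * 1"
    using v_mult[of 1 1] by simp
  thus ?thesis
    by (metis mult_cancel_left v_eq_0_iff zero_neq_one)
qed

lemma v_minus [simp]: "v (- x) = v x"
proof -
  have "v (- 1) * v (- 1) = 1"
    using v_mult[of "- 1" "- 1"] by simp
  hence "v (- 1) = 1"
    using v_nonneg[of "- 1"] unfolding square_eq_1_iff by auto
  thus ?thesis
    using v_mult[of "- 1" x] by simp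
qed

lemma v_inverse: "v (inverse x) = inverse (v x)"
proof (cases "x = 0")
  case False
  hence "v x * v (inverse x) = 1"
    by (metis right_inverse v_1 v_mult)
  thus ?thesis
    by (rule inverse_unique[symmetric])
qed simp

lemma v_divide: "v (x / y) = v x / v y"
  by (simp add: divide_inverse v_mult v_inverse)

lemma v_power: "v (x ^ n) = v x ^ n"
  by (induction n) (auto simp: v_mult)

lemma v_prod: "v (prod f A) = (\<Prod>x\<in>A. v (f x))"
  by (induction A rule: infinite_finite_induct) (auto simp: v_mult)

lemma v_diff_le_max: "v (x - y) \<le> max (v x) (v y)"
  using v_add_le_max[of x "- y"] by simp

lemma v_add_le: "v (x + y) \<le> v x + v y"
  using v_add_le_max[of x y] v_nonneg[of x] v_nonneg[of y] by linarith

lemma v_sum_le: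
  assumes "0 \<le> B" and "\<And>x. x \<in> A \<Longrightarrow> v (f x) \<le> B"
  shows "v (sum f A) \<le> B"
  using assms(2)
proof (induction A rule: infinite_finite_induct)
  case (insert x A)
  have "v (f x + sum f A) \<le> max (v (f x)) (v (sum f A))"
    by (rule v_add_le_max)
  also have "\<dots> \<le> B"
    using insert by auto
  finally show ?case
    using insert by simp
qed (use assms in auto)

lemma v_of_nat_le_1: "v (of_nat n) \<le> 1"
proof (induction n)
  case (Suc n)
  show ?case
    using v_add_le_max[of 1 "of_nat n"] Suc by simp
qed simp

lemma v_of_int_le_1: "v (of_int z) \<le> 1"
  using v_of_nat_le_1[of "nat z"] v_of_nat_le_1[of "nat (- z)"] v_minus[of "of_int z"]
  by (cases "z \<ge> 0") (simp_all flip: of_int_minus)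

lemma v_p_power: "v (of_nat p ^ n) = (1 / real p) ^ n"
  by (simp add: v_power v_p)

text \<open>
  A Bezout relation expresses \<open>1\<close> as an integral combination of \<open>z\<close> and \<open>p\<close>. The multiple of
  \<open>p\<close> has a value below \<open>1\<close>, so by the ultrametric inequality the multiple of \<open>z\<close> must reach \<open>1\<close>.
\<close>

lemma v_of_int_coprime:
  assumes "coprime z (int p)"
  shows "v (of_int z) = 1"
proof -
  obtain x y where xy: "x * z + y * int p = 1"
    using assms by (metis bezout_int coprime_iff_gcd_eq_1)
  have "1 = v (of_int (x * z + y * int p))"
    by (simp add: xy)
  also have "\<dots> \<le> max (v (of_int x) * v (of_int z)) (v (of_int y) * (1 / real p))"
    using v_add_le_max[of "of_int x * of_int z" "of_int y * of_nat p"]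
    by (simp add: v_mult v_p)
  finally have *: "1 \<le> max (v (of_int x) * v (of_int z)) (v (of_int y) * (1 / real p))" .
  have "v (of_int y) * (1 / real p) \<le> 1 / real p"
    using v_of_int_le_1[of y] by (simp add: divide_right_mono)
  also have "\<dots> < 1"
    using p_gt_1 by simp
  finally have "1 \<le> v (of_int x) * v (of_int z)"
    using * by simp
  also have "\<dots> \<le> v (of_int z)"
    using v_of_int_le_1[of x] by (simp add: mult_left_le_one_le)
  finally show ?thesis
    using v_of_int_le_1[of z] by simp
qed

lemma v_of_int_dvd_mono:
  assumes "a dvd b"
  shows "v (of_int b) \<le> v (of_int a)"
proof -
  from assms obtain c where "b = a * c" ..
  thus ?thesis
    using v_of_int_le_1[of c] by (simp add: v_mult mult_right_le_one_le)
qed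

text \<open>
  The trivial part of the product formula: the power of \<open>p\<close> in a nonzero integer is at most its
  size. It is what keeps a rational number from being very close to an integer.
\<close>

lemma v_of_int_ge:
  assumes "z \<noteq> 0"
  shows "1 / real_of_int \<bar>z\<bar> \<le> v (of_int z)"
proof -
  have "\<not> is_unit (int p)"
    using p_gt_1 by auto
  then obtain k w where kw: "z = int p ^ k * w" "\<not> int p dvd w"
    using multiplicity_decompose'[OF assms] assms by (metis mult.commute)
  have "prime (int p)"
    using prime_p by simp
  hence "coprime w (int p)"
    using kw(2) by (metis prime_imp_coprime coprime_commute)
  hence v: "v (of_int z) = (1 / real p) ^ k"
    using v_of_int_coprime by (simp add: kw(1) v_mult v_p_power)
  have "1 \<le> \<bar>w\<bar>"
    using assms kw(1) by auto
  hence "int p ^ k * 1 \<le> int p ^ k * \<bar>w\<bar>"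
    by (intro mult_left_mono) auto
  hence "int p ^ k \<le> \<bar>z\<bar>"
    by (simp add: kw(1) abs_mult)
  hence "real p ^ k \<le> real_of_int \<bar>z\<bar>"
    by (metis of_int_le_iff of_int_of_nat_eq of_int_power)
  moreover have "0 < real p ^ k"
    using p_gt_1 by simp
  ultimately have "1 / real_of_int \<bar>z\<bar> \<le> 1 / real p ^ k"
    using p_gt_1 assms by (intro divide_left_mono mult_pos_pos) auto
  thus ?thesis
    by (simp add: v power_divide)
qed

abbreviation \<pi> :: real where "\<pi> \<equiv> pi_place p v"

lemma pi_place_pos: "0 < \<pi>"
  using p_gt_1 by (simp add: pi_place_def v_p)

lemma pi_place_power: "\<pi> ^ (p - 1) = 1 / real p"
proof -
  have "\<pi> ^ (p - 1) = \<pi> powr real (p - 1)"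
    using pi_place_pos by (simp add: powr_realpow)
  also have "\<dots> = (1 / real p) powr 1"
    using p_gt_1 by (simp add: pi_place_def v_p powr_powr of_nat_diff)
  finally show ?thesis
    using p_gt_1 by simp
qed

lemma pi_place_less_1: "\<pi> < 1"
proof -
  have "(1 / real p) powr (1 / (real p - 1)) < 1 powr (1 / (real p - 1))"
    using p_gt_1 by (intro powr_less_mono2) auto
  thus ?thesis by (simp add: pi_place_def v_p)
qed

lemma v_of_nat_not_dvd:
  assumes "\<not> p dvd n"
  shows "v (of_nat n) = 1"
proof -
  have "coprime n p"
    using assms prime_p by (metis prime_imp_coprime coprime_commute)
  thus ?thesis
    using v_of_int_coprime[of "int n"] by simp
qed

lemma v_fact_add_less:
  assumes "r < p"
  shows "v (fact (p * m + r)) = v (fact (p * m))"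
  using assms
proof (induction r)
  case (Suc r)
  have "\<not> p dvd Suc (p * m + r)"
    using Suc.prems by (metis add_Suc_right dvd_add_right_iff dvd_triv_left nat_dvd_not_less zero_less_Suc)
  hence "v (of_nat (Suc (p * m + r))) = 1"
    by (rule v_of_nat_not_dvd)
  thus ?case
    using Suc by (simp add: v_mult del: of_nat_Suc)
qed simp

lemma v_fact_mult: "v (fact (p * m)) = (1 / real p) ^ m * v (fact m)"
proof (induction m)
  case (Suc m)
  have eq: "p * Suc m = Suc (p * m + (p - 1))"
    using p_gt_1 by simp
  have "v (fact (p * Suc m)) = v (of_nat (p * Suc m)) * v (fact (p * m + (p - 1)))"
    unfolding eq fact_Suc v_mult ..
  also have "v (fact (p * m + (p - 1))) = v (fact (p * m))"
    using p_gt_1 by (intro v_fact_add_less) simp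
  also have "v (of_nat (p * Suc m)) = 1 / real p * v (of_nat (Suc m))"
    unfolding of_nat_mult v_mult v_p ..
  finally show ?case
    unfolding Suc fact_Suc v_mult by (simp del: of_nat_Suc)
qed simp

lemma v_fact_div: "v (fact n) = (1 / real p) ^ (n div p) * v (fact (n div p))"
  using v_fact_add_less[of "n mod p" "n div p"] v_fact_mult[of "n div p"] p_gt_1 by simp

lemma pi_place_power_mult: "\<pi> ^ (p * m) = (1 / real p) ^ m * \<pi> ^ m"
proof -
  have "p * m = (p - 1) * m + m"
    using p_gt_1 by (simp add: algebra_simps flip: mult_Suc)
  thus ?thesis
    by (simp only: power_add power_mult pi_place_power)
qed

text \<open>
  Together the next two lemmas say that \<open>v (n!)\<close> is \<open>\<pi> ^ n\<close> up to a linear factor; both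
  follow from Legendre's recursion \<open>v (n!) = p ^ (- m) * v (m!)\<close> for \<open>m = n div p\<close>, because
  \<open>\<pi> ^ (p * m) = p ^ (- m) * \<pi> ^ m\<close>.
\<close>

lemma v_fact_ge: "\<pi> ^ n \<le> v (fact n)"
proof (induction n rule: less_induct)
  case (less n)
  show ?case
  proof (cases "n = 0")
    case False
    hence "n div p < n"
      using p_gt_1 by simp
    have "\<pi> ^ n \<le> \<pi> ^ (p * (n div p))"
      using pi_place_pos pi_place_less_1 by (intro power_decreasing) auto
    also have "\<dots> \<le> (1 / real p) ^ (n div p) * v (fact (n div p))"
      unfolding pi_place_power_mult using less[OF \<open>n div p < n\<close>] by (intro mult_left_mono) auto
    also have "\<dots> = v (fact n)"
      by (rule v_fact_div[symmetric])
    finally show ?thesis .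
  qed simp
qed

lemma v_fact_le: "v (fact n) \<le> real p * (real n + 1) * \<pi> ^ n"
proof -
  have pos: "v (fact n) \<le> real p * real n * \<pi> ^ n" if "0 < n" for n
    using that
  proof (induction n rule: less_induct)
    case (less n)
    let ?m = "n div p"
    have "p * ?m + n mod p = n"
      by simp
    hence "n \<le> p * ?m + (p - 1)"
      using mod_less_divisor[of p n] p_gt_1 by linarith
    hence "\<pi> ^ (p * ?m + (p - 1)) \<le> \<pi> ^ n"
      using pi_place_pos pi_place_less_1 by (intro power_decreasing) auto
    hence "\<pi> ^ (p * ?m) * (1 / real p) \<le> \<pi> ^ n"
      unfolding power_add pi_place_power .
    hence shift: "\<pi> ^ (p * ?m) \<le> real p * \<pi> ^ n"
      using p_gt_1 by (simp add: field_simps)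
    show ?case
    proof (cases "?m = 0")
      case True
      hence "v (fact n) = 1"
        using v_fact_div[of n] by simp
      also have "\<dots> \<le> real p * \<pi> ^ n"
        using shift True by simp
      also have "\<dots> \<le> real n * (real p * \<pi> ^ n)"
        using less.prems pi_place_pos mult_right_mono[of 1 "real n" "real p * \<pi> ^ n"] by simp
      finally show ?thesis
        by (simp add: mult_ac)
    next
      case False
      have "?m < n"
        using less.prems p_gt_1 by simp
      have "v (fact n) = (1 / real p) ^ ?m * v (fact ?m)"
        by (rule v_fact_div)
      also have "\<dots> \<le> (1 / real p) ^ ?m * (real p * real ?m * \<pi> ^ ?m)"
        using less.IH[OF \<open>?m < n\<close>] False by (intro mult_left_mono) auto
      also have "\<dots> = real (p * ?m) * \<pi> ^ (p * ?m)"
        by (simp add: pi_place_power_mult)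
      also have "\<dots> \<le> real n * (real p * \<pi> ^ n)"
        using shift pi_place_pos by (intro mult_mono) (auto simp del: of_nat_mult)
      finally show ?thesis
        by (simp add: mult_ac)
    qed
  qed
  show ?thesis
  proof (cases "n = 0")
    case False
    have "v (fact n) \<le> real p * real n * \<pi> ^ n"
      using False by (intro pos) simp
    also have "\<dots> \<le> real p * (real n + 1) * \<pi> ^ n"
      using pi_place_pos by (intro mult_mono) auto
    finally show ?thesis .
  qed (use p_gt_1 in simp)
qed

end

section \<open>Products over consecutive integers\<close>

context padic_place
begin

text \<open>The denominators of the elements of \<open>p_integral_rats p\<close> are units of the place.\<close>

lemma p_integral_rats_fraction:
  assumes "q \<in> p_integral_rats p"
  obtains a b where "q = of_int a / of_int b" "of_rat q = (of_int a / of_int b :: 'k)"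
    "0 < b" "coprime b (int p)"
    "\<And>k. v (of_rat q + of_int k) = v (of_int (a + k * b))"
proof -
  obtain a b where ab: "quotient_of q = (a, b)"
    by fastforce
  have b: "0 < b" "q = of_int a / of_int b"
    using quotient_of_denom_pos[OF ab] quotient_of_div[OF ab] by auto
  have cop: "coprime b (int p)"
    using assms ab by (simp add: p_integral_rats_def)
  have q: "of_rat q = (of_int a / of_int b :: 'k)"
    by (simp add: b(2) of_rat_divide)
  have "v (of_rat q + of_int k) = v (of_int (a + k * b))" for k
  proof -
    have "(of_rat q + of_int k :: 'k) = of_int (a + k * b) / of_int b"
      using b(1) by (simp add: q field_simps)
    thus ?thesis
      using v_of_int_coprime[OF cop] by (simp add: v_divide)
  qed
  with b q cop that show thesis by blast
qed

text \<open>
  Since \<open>q\<close> is a fixed rational number, its distance to an integer decreases only polynomially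
  in the size of the integer. For a general \<open>p\<close>-adic integer in place of \<open>q\<close> this fails, and
  with it the estimate for the inverse matrices.
\<close>

lemma v_rat_add_int_ge:
  assumes "q \<in> p_integral_rats p" and "q \<notin> \<int>"
  obtains c where "1 \<le> c"
    "\<And>k. 1 / (c * (real_of_int \<bar>k\<bar> + 1)) \<le> v (of_rat q + of_int k)"
proof -
  obtain a b where ab: "q = of_int a / of_int b" "0 < b"
      "\<And>k. v (of_rat q + of_int k) = v (of_int (a + k * b))"
    using p_integral_rats_fraction[OF assms(1)] by metis
  define c where "c = real_of_int (\<bar>a\<bar> + b)"
  have "1 / (c * (real_of_int \<bar>k\<bar> + 1)) \<le> v (of_rat q + of_int k)" for k
  proof -
    have nz: "a + k * b \<noteq> 0"
    proof
      assume "a + k * b = 0"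
      hence "a = - k * b" by simp
      hence "q = of_int (- k)"
        using ab by simp
      thus False
        using assms(2) by simp
    qed
    have "\<bar>a + k * b\<bar> \<le> \<bar>a\<bar> + \<bar>k\<bar> * b"
      using abs_triangle_ineq[of a "k * b"] ab(2) by (simp add: abs_mult)
    also have "\<dots> \<le> (\<bar>a\<bar> + b) * (\<bar>k\<bar> + 1)"
      using ab(2) by (simp add: algebra_simps)
    finally have "real_of_int \<bar>a + k * b\<bar> \<le> real_of_int ((\<bar>a\<bar> + b) * (\<bar>k\<bar> + 1))"
      by (rule of_int_le_iff[THEN iffD2])
    also have "\<dots> = c * (real_of_int \<bar>k\<bar> + 1)"
      by (simp add: c_def)
    finally have "1 / (c * (real_of_int \<bar>k\<bar> + 1)) \<le> 1 / real_of_int \<bar>a + k * b\<bar>"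
      using nz ab(2) by (intro divide_left_mono mult_pos_pos) (simp_all add: c_def del: of_int_add of_int_mult)
    also have "\<dots> \<le> v (of_int (a + k * b))"
      by (rule v_of_int_ge[OF nz])
    finally show ?thesis
      by (simp add: ab(3))
  qed
  moreover have "1 \<le> c"
    using ab(2) by (simp add: c_def)
  ultimately show thesis
    using that by blast
qed

text \<open>The integers are dense in the \<open>p\<close>-integral rationals: invert the denominator modulo \<open>p ^ M\<close>.\<close>

lemma ex_int_close:
  assumes "q \<in> p_integral_rats p"
  obtains A where "v (of_rat q - of_int A) \<le> (1 / real p) ^ M"
proof -
  obtain a b where ab: "of_rat q = (of_int a / of_int b :: 'k)" "0 < b" "coprime b (int p)"
    using p_integral_rats_fraction[OF assms] by metis
  have "coprime b (int p ^ M)"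
    using ab(3) by simp
  then obtain x y where xy: "x * b + y * int p ^ M = 1"
    by (metis bezout_int coprime_iff_gcd_eq_1)
  have "of_rat q - of_int (a * x) = (of_int (a * (1 - x * b)) / of_int b :: 'k)"
    using ab(1,2) by (simp add: field_simps)
  also have "1 - x * b = y * int p ^ M"
    using xy by simp
  finally have "v (of_rat q - of_int (a * x)) = v (of_int (a * y)) * (1 / real p) ^ M"
    using v_of_int_coprime[OF ab(3)]
    by (simp add: v_divide v_mult flip: v_p_power)
  also have "\<dots> \<le> 1 * (1 / real p) ^ M"
    by (intro mult_right_mono v_of_int_le_1) auto
  finally show thesis
    using that[of "a * x"] by simp
qed

text \<open>
  Upper bound: a product of \<open>N\<close> consecutive integers is divisible by \<open>N!\<close>, and by
  density of the integers the same holds \<open>p\<close>-adically with \<open>q\<close> added to every factor.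
\<close>

lemma v_prod_consecutive_le:
  assumes "q \<in> p_integral_rats p"
  shows "(\<Prod>k<N. v (of_rat q + of_int (m + int k))) \<le> v (fact N)"
proof (cases "\<exists>k<N. (of_rat q + of_int (m + int k) :: 'k) = 0")
  case True
  then obtain k where "k < N" "(of_rat q + of_int (m + int k) :: 'k) = 0" by blast
  hence "(\<Prod>k<N. v (of_rat q + of_int (m + int k))) = 0"
    by (intro prod_zero) auto
  thus ?thesis
    by (simp only: v_nonneg)
next
  case False
  \<comment> \<open>If an integer \<open>A\<close> is closer to \<open>q\<close> than \<open>q\<close> is to any of the integers
    \<open>- m - k\<close>, replacing \<open>q\<close> by \<open>A\<close> does not decrease any factor.\<close>
  have "\<exists>e>0. \<forall>k<N. e < v (of_rat q + of_int (m + int k))"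
  proof -
    define e where "e = Min (insert 1 ((\<lambda>k. v (of_rat q + of_int (m + int k))) ` {..<N})) / 2"
    have pos: "0 < e"
      using False v_pos by (auto simp: e_def)
    have "2 * e \<le> v (of_rat q + of_int (m + int k))" if "k < N" for k
      unfolding e_def using that by (auto intro!: Min_le)
    with pos show ?thesis
      by (intro exI[of _ e]) force
  qed
  then obtain e where e: "0 < e" "\<And>k. k < N \<Longrightarrow> e < v (of_rat q + of_int (m + int k))"
    by blast
  have "1 / real p < 1"
    using p_gt_1 by simp
  then obtain M where M: "(1 / real p) ^ M < e"
    using real_arch_pow_inv[OF e(1)] by blast
  obtain A where A: "v (of_rat q - of_int A) \<le> (1 / real p) ^ M"
    using ex_int_close[OF assms] by blast
  have "v (of_rat q + of_int (m + int k)) \<le> v (of_int (A + m + int k))" if "k < N" for k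
  proof -
    have "v (of_rat q + of_int (m + int k))
        \<le> max (v (of_rat q - of_int A)) (v (of_int (A + m + int k)))"
      using v_add_le_max[of "of_rat q - of_int A" "of_int (A + m + int k)"] by simp
    moreover have "v (of_rat q - of_int A) < v (of_rat q + of_int (m + int k))"
      using A M e(2)[OF that] by linarith
    ultimately show ?thesis by simp
  qed
  hence "(\<Prod>k<N. v (of_rat q + of_int (m + int k))) \<le> (\<Prod>k<N. v (of_int (A + m + int k)))"
    by (intro prod_mono) auto
  also have "\<dots> = v (of_int (pochhammer (A + m) N))"
    by (simp add: pochhammer_prod v_prod atLeast0LessThan)
  also have "\<dots> \<le> v (of_int (fact N))"
    by (intro v_of_int_dvd_mono fact_dvd_pochhammer)
  finally show ?thesis by simp
qed

text \<open>
  Lower bound: let \<open>k\<^sub>0\<close> be the index of the smallest factor \<open>x + k\<close>. By the ultrametric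
  inequality every other factor is at least as large as \<open>k - k\<^sub>0\<close>, and the product of these
  differences is \<open>k\<^sub>0! (N - 1 - k\<^sub>0)!\<close> up to sign, a divisor of \<open>(N - 1)!\<close>.
\<close>

lemma v_prod_consecutive_ge:
  assumes "\<And>k. k < N \<Longrightarrow> \<delta> \<le> v (x + of_nat k)" and "0 < N" and "0 \<le> \<delta>"
  shows "v (fact (N - 1)) * \<delta> \<le> (\<Prod>k<N. v (x + of_nat k))"
proof -
  define f where "f = (\<lambda>k. v (x + of_nat k))"
  obtain k0 where k0: "k0 < N" "\<And>k. k < N \<Longrightarrow> f k0 \<le> f k"
    using ex_min_if_finite[of "f ` {..<N}"] \<open>0 < N\<close> by (force simp: not_less)
  have dist: "v (of_int (int k - int k0)) \<le> f k" if "k < N" for k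
  proof -
    have "v (of_int (int k - int k0)) \<le> max (f k) (f k0)"
      using v_diff_le_max[of "x + of_nat k" "x + of_nat k0"] by (simp add: f_def)
    thus ?thesis
      using k0(2)[OF that] by simp
  qed
  have split: "{..<N} = insert k0 ({..<k0} \<union> {k0<..<N})"
    using k0(1) by auto
  have low: "(\<Prod>k<k0. v (of_int (int k - int k0))) = v (fact k0)"
  proof -
    have "(\<Prod>k<k0. v (of_int (int k - int k0))) = (\<Prod>k<k0. v (of_nat (k0 - k)))"
    proof (rule prod.cong)
      fix k assume "k \<in> {..<k0}"
      hence "(of_int (int k - int k0) :: 'k) = - of_nat (k0 - k)"
        by (simp add: of_nat_diff)
      thus "v (of_int (int k - int k0)) = v (of_nat (k0 - k))" by simp
    qed simp
    also have "\<dots> = (\<Prod>k<k0. v (of_nat (Suc k)))"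
      by (rule prod.reindex_bij_witness[of _ "\<lambda>k. k0 - Suc k" "\<lambda>k. k0 - Suc k"])
        (auto simp: Suc_diff_Suc)
    also have "\<dots> = v (fact k0)"
      by (simp add: fact_prod_Suc v_prod atLeast0LessThan)
    finally show ?thesis .
  qed
  have high: "(\<Prod>k\<in>{k0<..<N}. v (of_int (int k - int k0))) = v (fact (N - 1 - k0))"
  proof -
    have "(\<Prod>k\<in>{k0<..<N}. v (of_int (int k - int k0))) = (\<Prod>k<N - 1 - k0. v (of_nat (Suc k)))"
      by (rule prod.reindex_bij_witness[of _ "\<lambda>k. k0 + Suc k" "\<lambda>k. k - Suc k0"])
        (auto simp: of_nat_diff)
    also have "\<dots> = v (fact (N - 1 - k0))"
      by (simp add: fact_prod_Suc v_prod atLeast0LessThan)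
    finally show ?thesis .
  qed
  have "fact k0 * fact (N - 1 - k0) dvd (fact (N - 1) :: int)"
    using fact_fact_dvd_fact[of k0 "N - 1 - k0"] k0(1) by simp
  hence "v (fact (N - 1)) \<le> v (fact k0) * v (fact (N - 1 - k0))"
    using v_of_int_dvd_mono by (fastforce simp flip: v_mult)
  also have "\<dots> = (\<Prod>k\<in>{..<k0} \<union> {k0<..<N}. v (of_int (int k - int k0)))"
    unfolding low[symmetric] high[symmetric] by (rule prod.union_disjoint[symmetric]) auto
  also have "\<dots> \<le> (\<Prod>k\<in>{..<k0} \<union> {k0<..<N}. f k)"
    using dist k0(1) by (intro prod_mono) auto
  finally have "v (fact (N - 1)) * \<delta> \<le> (\<Prod>k\<in>{..<k0} \<union> {k0<..<N}. f k) * f k0"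
    using assms(1)[OF k0(1)] \<open>0 \<le> \<delta>\<close> by (intro mult_mono) (auto simp: f_def intro!: prod_nonneg)
  also have "\<dots> = prod f {..<N}"
    unfolding split by (subst prod.insert) auto
  finally show ?thesis
    by (simp add: f_def)
qed

text \<open>
  The next two lemmas put both bounds into the form that the recurrences of the matrices use.
  The linear factor depends on \<open>n\<close> alone, uniformly in the lower end \<open>m\<close> of the interval.
\<close>

lemma prod_shift_le:
  assumes "q \<in> p_integral_rats p" and "m \<le> n"
  shows "(\<Prod>k=m..<n. v (of_rat q + of_nat (Suc k))) \<le> real p * (real n + 1) * \<pi> ^ (n - m)"
proof -
  have "(\<Prod>k=m..<n. v (of_rat q + of_nat (Suc k)))
      = (\<Prod>k<n - m. v (of_rat q + of_int (int m + 1 + int k)))"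
    by (rule prod.reindex_bij_witness[of _ "\<lambda>k. k + m" "\<lambda>k. k - m"])
      (auto simp: of_nat_diff algebra_simps)
  also have "\<dots> \<le> v (fact (n - m))"
    by (rule v_prod_consecutive_le[OF assms(1)])
  also have "\<dots> \<le> real p * (real (n - m) + 1) * \<pi> ^ (n - m)"
    by (rule v_fact_le)
  also have "\<dots> \<le> real p * (real n + 1) * \<pi> ^ (n - m)"
    using pi_place_pos by (intro mult_right_mono mult_left_mono) auto
  finally show ?thesis .
qed

lemma prod_inverse_shift_le:
  assumes "q \<in> p_integral_rats p" and "q \<notin> \<int>"
  obtains c where "1 \<le> c"
    "\<And>m n. m \<le> n \<Longrightarrow>
       (\<Prod>k=m..<n. inverse (v (of_rat q - of_nat k))) \<le> c * (real n + 1) * inverse \<pi> ^ (n - m)"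
proof -
  obtain c where c: "1 \<le> c" "\<And>k. 1 / (c * (real_of_int \<bar>k\<bar> + 1)) \<le> v (of_rat q + of_int k)"
    using v_rat_add_int_ge[OF assms] by blast
  have "(\<Prod>k=m..<n. inverse (v (of_rat q - of_nat k))) \<le> c * (real n + 1) * inverse \<pi> ^ (n - m)"
    if "m \<le> n" for m n
  proof (cases "m = n")
    case True
    have "1 * 1 \<le> c * (real n + 1)"
      using c(1) by (intro mult_mono) auto
    thus ?thesis
      using True by simp
  next
    case False
    hence "m < n" using that by simp
    define N where "N = n - m"
    define \<delta> where "\<delta> = 1 / (c * (real n + 1))"
    \<comment> \<open>the last factor \<open>q - (n - 1)\<close>; the others follow in steps of \<open>1\<close>\<close>
    define x where "x = (of_rat q + of_int (1 - int n) :: 'k)"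
    have "0 < \<delta>"
      using c(1) by (simp add: \<delta>_def add_pos_nonneg)
    have "\<delta> \<le> v (x + of_nat k)" if "k < N" for k
    proof -
      have "\<delta> \<le> 1 / (c * (real_of_int \<bar>1 - int n + int k\<bar> + 1))"
        using that c(1) unfolding \<delta>_def N_def
        by (intro divide_left_mono mult_left_mono mult_pos_pos) auto
      also have "\<dots> \<le> v (x + of_nat k)"
        using c(2)[of "1 - int n + int k"] by (simp add: x_def algebra_simps)
      finally show ?thesis .
    qed
    hence "v (fact (N - 1)) * \<delta> \<le> (\<Prod>k<N. v (x + of_nat k))"
      using \<open>m < n\<close> \<open>0 < \<delta>\<close> by (intro v_prod_consecutive_ge) (auto simp: N_def)
    also have "\<dots> = (\<Prod>k=m..<n. v (of_rat q - of_nat k))"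
      by (rule prod.reindex_bij_witness[of _ "\<lambda>k. n - Suc k" "\<lambda>k. n - Suc k"])
        (auto simp: x_def N_def of_nat_diff algebra_simps)
    finally have *: "v (fact (N - 1)) * \<delta> \<le> (\<Prod>k=m..<n. v (of_rat q - of_nat k))" .
    have "\<pi> ^ N \<le> \<pi> ^ (N - 1)"
      using pi_place_pos pi_place_less_1 by (intro power_decreasing) auto
    also have "\<dots> \<le> v (fact (N - 1))"
      by (rule v_fact_ge)
    finally have "\<pi> ^ N * \<delta> \<le> (\<Prod>k=m..<n. v (of_rat q - of_nat k))"
      using * \<open>0 < \<delta>\<close> by (meson mult_right_mono order_trans less_imp_le)
    moreover have "0 < \<pi> ^ N * \<delta>"
      using pi_place_pos \<open>0 < \<delta>\<close> by simp
    ultimately have "inverse (\<Prod>k=m..<n. v (of_rat q - of_nat k)) \<le> inverse (\<pi> ^ N * \<delta>)"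
      by (intro le_imp_inverse_le)
    also have "inverse (\<pi> ^ N * \<delta>) = c * (real n + 1) * inverse \<pi> ^ (n - m)"
      by (simp add: \<delta>_def N_def field_simps)
    also have "inverse (\<Prod>k=m..<n. v (of_rat q - of_nat k)) = (\<Prod>k=m..<n. inverse (v (of_rat q - of_nat k)))"
      using prod_inversef[of "\<lambda>k. v (of_rat q - of_nat k)"] by (simp add: o_def)
    finally show ?thesis .
  qed
  with c(1) that show thesis by blast
qed

end

section \<open>Sequences of exponential growth up to polynomial factors\<close>

text \<open>
  Growth at most \<open>\<rho> ^ n\<close> up to a factor that is invisible to \<open>n\<close>-th roots. That the factor is
  polynomial, and not just subexponential, makes the closure properties elementary.
\<close>

definition poly_growth :: "real \<Rightarrow> (nat \<Rightarrow> real) \<Rightarrow> bool" where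
  "poly_growth \<rho> f \<longleftrightarrow> (\<exists>C e. 0 \<le> C \<and> (\<forall>n. f n \<le> C * (real n + 1) ^ e * \<rho> ^ n))"

lemma poly_growthI:
  assumes "0 \<le> C" and "\<And>n. f n \<le> C * (real n + 1) ^ e * \<rho> ^ n"
  shows "poly_growth \<rho> f"
  using assms unfolding poly_growth_def by blast

lemma poly_growthE:
  assumes "poly_growth \<rho> f"
  obtains C e where "0 \<le> C" "\<And>n. f n \<le> C * (real n + 1) ^ e * \<rho> ^ n"
  using assms unfolding poly_growth_def by blast

lemma poly_growth_mono:
  assumes "poly_growth \<rho> g" and "\<And>n. f n \<le> g n"
  shows "poly_growth \<rho> f"
  using assms unfolding poly_growth_def by (meson order_trans)

lemma poly_growth_zero: "poly_growth \<rho> (\<lambda>n. 0)"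
  by (rule poly_growthI[of 0]) auto

lemma poly_growth_add:
  assumes "0 \<le> \<rho>" and "poly_growth \<rho> f" and "poly_growth \<rho> g"
  shows "poly_growth \<rho> (\<lambda>n. f n + g n)"
proof -
  obtain C e where f: "0 \<le> C" "\<And>n. f n \<le> C * (real n + 1) ^ e * \<rho> ^ n"
    using poly_growthE[OF assms(2)] by blast
  obtain D e' where g: "0 \<le> D" "\<And>n. g n \<le> D * (real n + 1) ^ e' * \<rho> ^ n"
    using poly_growthE[OF assms(3)] by blast
  show ?thesis
  proof (rule poly_growthI)
    fix n
    have "f n + g n \<le> C * (real n + 1) ^ e * \<rho> ^ n + D * (real n + 1) ^ e' * \<rho> ^ n"
      using f(2) g(2) by (rule add_mono)
    also have "\<dots> \<le> C * (real n + 1) ^ max e e' * \<rho> ^ n + D * (real n + 1) ^ max e e' * \<rho> ^ n"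
      using f(1) g(1) \<open>0 \<le> \<rho>\<close>
      by (intro add_mono mult_right_mono mult_left_mono power_increasing) auto
    finally show "f n + g n \<le> (C + D) * (real n + 1) ^ max e e' * \<rho> ^ n"
      by (simp add: algebra_simps)
  qed (use f g in simp)
qed

lemma poly_growth_sum:
  assumes "0 \<le> \<rho>" and "\<And>i. i \<in> I \<Longrightarrow> poly_growth \<rho> (f i)"
  shows "poly_growth \<rho> (\<lambda>n. \<Sum>i\<in>I. f i n)"
  using assms(2)
  by (induction I rule: infinite_finite_induct)
    (auto intro: poly_growth_zero poly_growth_add[OF assms(1)])

lemma poly_growth_linear_mult:
  assumes "0 \<le> \<rho>" and "0 \<le> c" and "poly_growth \<rho> f"
  shows "poly_growth \<rho> (\<lambda>n. c * (real n + 1) * f n)"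
proof -
  obtain C e where f: "0 \<le> C" "\<And>n. f n \<le> C * (real n + 1) ^ e * \<rho> ^ n"
    using poly_growthE[OF assms(3)] by blast
  show ?thesis
  proof (rule poly_growthI)
    fix n
    have "c * (real n + 1) * f n \<le> c * (real n + 1) * (C * (real n + 1) ^ e * \<rho> ^ n)"
      using f(2) assms(2) by (intro mult_left_mono) auto
    thus "c * (real n + 1) * f n \<le> (c * C) * (real n + 1) ^ Suc e * \<rho> ^ n"
      by (simp add: mult_ac)
  qed (use f assms in simp)
qed

lemma poly_growth_Suc:
  assumes "0 \<le> \<rho>" and "poly_growth \<rho> f"
  shows "poly_growth \<rho> (\<lambda>n. f (Suc n))"
proof -
  obtain C e where f: "0 \<le> C" "\<And>n. f n \<le> C * (real n + 1) ^ e * \<rho> ^ n"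
    using poly_growthE[OF assms(2)] by blast
  show ?thesis
  proof (rule poly_growthI)
    fix n
    have "f (Suc n) \<le> C * (real (Suc n) + 1) ^ e * \<rho> ^ Suc n"
      by (rule f(2))
    also have "\<dots> \<le> C * (2 * (real n + 1)) ^ e * \<rho> ^ Suc n"
      using f(1) assms(1) by (intro mult_right_mono mult_left_mono power_mono) auto
    finally show "f (Suc n) \<le> (C * 2 ^ e * \<rho>) * (real n + 1) ^ e * \<rho> ^ n"
      by (simp only: power_mult_distrib power_Suc mult_ac)
  qed (use f assms in simp)
qed

lemma poly_growth_power_mult:
  assumes "0 \<le> \<sigma>" and "poly_growth \<rho> f"
  shows "poly_growth (\<rho> * \<sigma>) (\<lambda>n. \<sigma> ^ n * f n)"
proof -
  obtain C e where f: "0 \<le> C" "\<And>n. f n \<le> C * (real n + 1) ^ e * \<rho> ^ n"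
    using poly_growthE[OF assms(2)] by blast
  show ?thesis
  proof (rule poly_growthI[OF f(1)])
    fix n
    have "\<sigma> ^ n * f n \<le> \<sigma> ^ n * (C * (real n + 1) ^ e * \<rho> ^ n)"
      using assms(1) f(2) by (intro mult_left_mono) auto
    thus "\<sigma> ^ n * f n \<le> C * (real n + 1) ^ e * (\<rho> * \<sigma>) ^ n"
      by (simp add: power_mult_distrib mult_ac)
  qed
qed

context padic_place
begin

text \<open>
  Variation of constants: the solution of an inhomogeneous first-order recurrence is a sum of
  terms, each a value of the inhomogeneity times a product of multipliers over an interval. This
  is why the products over all intervals are needed, not only those that start at \<open>0\<close>.
\<close>

lemma poly_growth_recurrence:
  fixes x a b :: "nat \<Rightarrow> 'k"
  assumes "0 < \<rho>" and "0 \<le> c"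
    and rec: "\<And>n. x (Suc n) = a n * x n + b n"
    and a: "\<And>m n. m \<le> n \<Longrightarrow> (\<Prod>k=m..<n. v (a k)) \<le> c * (real n + 1) * \<rho> ^ (n - m)"
    and b: "poly_growth \<rho> (\<lambda>n. v (b n))"
  shows "poly_growth \<rho> (\<lambda>n. v (x n))"
proof -
  obtain C e where C: "0 \<le> C" "\<And>n. v (b n) \<le> C * (real n + 1) ^ e * \<rho> ^ n"
    using poly_growthE[OF b] by blast
  have sol: "x n = (\<Prod>k=0..<n. a k) * x 0 + (\<Sum>m<n. (\<Prod>k=Suc m..<n. a k) * b m)" for n
    by (induction n) (simp_all add: rec algebra_simps sum_distrib_left)
  show ?thesis
  proof (rule poly_growthI)
    fix n
    have "v (\<Sum>m<n. (\<Prod>k=Suc m..<n. a k) * b m) \<le> c * C / \<rho> * (real n + 1) ^ Suc e * \<rho> ^ n"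
    proof (rule v_sum_le)
      fix m assume "m \<in> {..<n}"
      hence "Suc m \<le> n" by simp
      have "v ((\<Prod>k=Suc m..<n. a k) * b m)
          \<le> (c * (real n + 1) * \<rho> ^ (n - Suc m)) * (C * (real m + 1) ^ e * \<rho> ^ m)"
        unfolding v_mult v_prod using a[OF \<open>Suc m \<le> n\<close>] C assms(1,2) by (intro mult_mono) auto
      also have "\<dots> \<le> (c * (real n + 1) * \<rho> ^ (n - Suc m)) * (C * (real n + 1) ^ e * \<rho> ^ m)"
        using C(1) assms(1,2) \<open>Suc m \<le> n\<close>
        by (intro mult_left_mono mult_right_mono power_mono) auto
      also have "\<dots> = c * C * (real n + 1) ^ Suc e * \<rho> ^ (n - Suc m + m)"
        by (simp add: power_add mult_ac)
      also have "\<rho> ^ (n - Suc m + m) = \<rho> ^ n / \<rho>"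
      proof -
        have "n = Suc (n - Suc m + m)"
          using \<open>Suc m \<le> n\<close> by simp
        hence "\<rho> ^ n = \<rho> * \<rho> ^ (n - Suc m + m)"
          by (metis power_Suc)
        thus ?thesis
          using assms(1) by simp
      qed
      finally show "v ((\<Prod>k=Suc m..<n. a k) * b m) \<le> c * C / \<rho> * (real n + 1) ^ Suc e * \<rho> ^ n"
        by (simp add: field_simps)
    qed (use C assms in simp)
    moreover have "v ((\<Prod>k=0..<n. a k) * x 0) \<le> c * v (x 0) * (real n + 1) ^ Suc e * \<rho> ^ n"
    proof -
      have "v ((\<Prod>k=0..<n. a k) * x 0) \<le> c * (real n + 1) * \<rho> ^ n * v (x 0)"
        unfolding v_mult v_prod using a[of 0 n] by (intro mult_right_mono) auto
      also have "\<dots> = c * v (x 0) * (real n + 1) ^ 1 * \<rho> ^ n"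
        by (simp add: mult_ac)
      also have "\<dots> \<le> c * v (x 0) * (real n + 1) ^ Suc e * \<rho> ^ n"
        using assms(1,2) by (intro mult_right_mono mult_left_mono power_increasing) auto
      finally show ?thesis .
    qed
    ultimately have "v (x n) \<le> c * v (x 0) * (real n + 1) ^ Suc e * \<rho> ^ n
        + c * C / \<rho> * (real n + 1) ^ Suc e * \<rho> ^ n"
      unfolding sol[of n] using v_add_le by (meson add_mono order_trans)
    thus "v (x n) \<le> (c * v (x 0) + c * C / \<rho>) * (real n + 1) ^ Suc e * \<rho> ^ n"
      by (simp only: distrib_right)
  qed (use C assms in simp)
qed

end

section \<open>Matrices with rational eigenvalues\<close>

lemma mat_prod_Nil [simp]: "mat_prod n [] = 1\<^sub>m n"
  and mat_prod_Cons [simp]: "mat_prod n (M # Ms) = M * mat_prod n Ms"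
  by (simp_all add: mat_prod_def)

lemma mat_prod_carrier:
  assumes "set Ms \<subseteq> carrier_mat n n"
  shows "mat_prod n Ms \<in> carrier_mat n n"
  using assms by (induction Ms) (auto intro!: mult_carrier_mat)

lemma mat_prod_snoc:
  assumes "set Ms \<subseteq> carrier_mat n n" and "M \<in> carrier_mat n n"
  shows "mat_prod n (Ms @ [M]) = mat_prod n Ms * M"
  using assms(1)
proof (induction Ms)
  case (Cons N Ms)
  hence "N * (mat_prod n Ms * M) = N * mat_prod n Ms * M"
    using assms(2) mat_prod_carrier[of Ms n] by (intro assoc_mult_mat[symmetric]) auto
  thus ?case
    using Cons by simp
qed (use assms(2) in simp)

lemma mat_shift_conv_char_matrix:
  assumes "L \<in> carrier_mat n n"
  shows "mat_shift L k = char_matrix L x + (x + of_int k) \<cdot>\<^sub>m 1\<^sub>m n"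
  using assms unfolding mat_shift_def char_matrix_def by (intro eq_matI) auto

lemma mat_shift_carrier [intro, simp]:
  assumes "L \<in> carrier_mat n n"
  shows "mat_shift L k \<in> carrier_mat n n"
  using assms unfolding mat_shift_def by auto

lemma mat_shift_mult_left:
  assumes "L \<in> carrier_mat n n" and "M \<in> carrier_mat n n"
  shows "mat_shift L k * M = char_matrix L x * M + (x + of_int k) \<cdot>\<^sub>m M"
  using assms unfolding mat_shift_conv_char_matrix[OF assms(1), of k x]
  by (simp add: add_mult_distrib_mat[of _ n n] mult_smult_assoc_mat[of _ n n])

text \<open>
  The Cayley--Hamilton theorem for triangular matrices: the product of the first \<open>k\<close> factors
  kills the first \<open>k\<close> vectors of the standard basis, since a triangular matrix preserves the flag
  that they generate and its \<open>k\<close>-th diagonal entry is its eigenvalue on the \<open>k\<close>-th step.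
\<close>

lemma upper_triangular_annihilated:
  fixes T :: "'a::field mat"
  assumes T: "T \<in> carrier_mat n n" and tri: "upper_triangular T"
  shows "mat_prod n (map (char_matrix T) (diag_mat T)) = 0\<^sub>m n n"
proof -
  define W where "W k = mat_prod n (map (char_matrix T) (take k (diag_mat T)))" for k
  have len: "length (diag_mat T) = n"
    using T by (simp add: diag_mat_def)
  have cT: "char_matrix T q \<in> carrier_mat n n" for q
    using T by simp
  have cW: "W k \<in> carrier_mat n n" for k
    unfolding W_def using cT by (intro mat_prod_carrier) auto
  have "\<forall>i<n. \<forall>j<k. W k $$ (i, j) = 0" if "k \<le> n" for k
    using that
  proof (induction k)
    case (Suc k)
    hence k: "k < n" by simp
    have "take (Suc k) (diag_mat T) = take k (diag_mat T) @ [T $$ (k, k)]"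
      using k T len by (simp add: take_Suc_conv_app_nth diag_mat_def)
    hence W: "W (Suc k) = W k * char_matrix T (T $$ (k, k))"
      using cT unfolding W_def by (simp add: mat_prod_snoc image_subset_iff)
    show ?case
    proof (intro allI impI)
      fix i j assume i: "i < n" and j: "j < Suc k"
      have "W (Suc k) $$ (i, j)
          = (\<Sum>l=0..<n. W k $$ (i, l) * char_matrix T (T $$ (k, k)) $$ (l, j))"
        using i j k cW[of k] cT[of "T $$ (k, k)"] by (simp add: W scalar_prod_def)
      also have "\<dots> = 0"
      proof (rule sum.neutral, intro ballI)
        fix l assume l: "l \<in> {0..<n}"
        have "W k $$ (i, l) = 0 \<or> char_matrix T (T $$ (k, k)) $$ (l, j) = 0"
        proof (cases "l < k")
          case True
          thus ?thesis
            using Suc i k by simp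
        next
          case False
          hence "l = k \<and> j = k \<or> j < l"
            using j by auto
          hence "char_matrix T (T $$ (k, k)) $$ (l, j) = 0"
            using T tri l j k by (auto simp: char_matrix_def)
          thus ?thesis ..
        qed
        thus "W k $$ (i, l) * char_matrix T (T $$ (k, k)) $$ (l, j) = 0" by auto
      qed
      finally show "W (Suc k) $$ (i, j) = 0" .
    qed
  qed simp
  hence "W n = 0\<^sub>m n n"
    using cW[of n] by (intro eq_matI) auto
  thus ?thesis
    by (simp add: W_def len)
qed

lemma char_matrix_similar:
  fixes A :: "'a::field mat"
  assumes A: "A \<in> carrier_mat n n" and sim: "similar_mat_wit A T P Q"
  shows "char_matrix A q = P * char_matrix T q * Q"
proof -
  have c: "T \<in> carrier_mat n n" "P \<in> carrier_mat n n" "Q \<in> carrier_mat n n"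
      and PQ: "P * Q = 1\<^sub>m n" "A = P * T * Q"
    using similar_mat_witD2[OF A sim] by auto
  have "P * char_matrix T q * Q = P * T * Q + P * (- q \<cdot>\<^sub>m 1\<^sub>m n) * Q"
    using c by (simp add: char_matrix_def mult_add_distrib_mat[of _ n n] add_mult_distrib_mat[of _ n n])
  also have "P * (- q \<cdot>\<^sub>m 1\<^sub>m n) * Q = - q \<cdot>\<^sub>m (P * Q)"
  proof -
    have "P * (- q \<cdot>\<^sub>m 1\<^sub>m n) = - q \<cdot>\<^sub>m (P * 1\<^sub>m n)"
      using c(2) by (intro mult_smult_distrib) auto
    thus ?thesis
      using c by (simp add: mult_smult_assoc_mat[of _ n n])
  qed
  finally show ?thesis
    using A c by (simp add: char_matrix_def PQ)
qed

lemma mat_prod_similar: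
  fixes A :: "'a::field mat"
  assumes A: "A \<in> carrier_mat n n" and sim: "similar_mat_wit A T P Q"
  shows "mat_prod n (map (char_matrix A) qs) = P * mat_prod n (map (char_matrix T) qs) * Q"
proof (induction qs)
  case Nil
  thus ?case
    using similar_mat_witD2[OF A sim] by simp
next
  case (Cons q qs)
  have c: "T \<in> carrier_mat n n" "P \<in> carrier_mat n n" "Q \<in> carrier_mat n n" "Q * P = 1\<^sub>m n"
    using similar_mat_witD2[OF A sim] by auto
  define B where "B = char_matrix T q"
  define W where "W = mat_prod n (map (char_matrix T) qs)"
  have cB: "B \<in> carrier_mat n n"
    using c by (simp add: B_def)
  have cW: "W \<in> carrier_mat n n"
    using c unfolding W_def by (intro mat_prod_carrier) auto
  have "(P * B * Q) * (P * W * Q) = P * B * (Q * P) * W * Q"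
    using c(1-3) cB cW by (simp add: assoc_mult_mat[of _ n n _ n _ n])
  also have "\<dots> = P * (B * W) * Q"
    using c cB cW by (simp add: assoc_mult_mat[of _ n n _ n _ n])
  finally show ?case
    using Cons by (simp add: char_matrix_similar[OF A sim] B_def W_def)
qed

context field_hom
begin

lemma mat_hom_char_matrix:
  assumes "A \<in> carrier_mat n n"
  shows "char_matrix (mat\<^sub>h A) (hom q) = mat\<^sub>h (char_matrix A q)"
  using assms unfolding char_matrix_def by (intro eq_matI) (auto simp: hom_distribs)

lemma mat_hom_mat_prod:
  assumes "set Ms \<subseteq> carrier_mat n n"
  shows "mat_prod n (map mat\<^sub>h Ms) = mat\<^sub>h (mat_prod n Ms)"
  using assms
proof (induction Ms)
  case (Cons M Ms)
  thus ?case
    using mat_prod_carrier[of Ms n] by (simp add: mat_hom_mult[of _ n n _ n])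
qed (simp add: mat_hom_one)

lemma mat_hom_prod_char_matrix:
  assumes "A \<in> carrier_mat n n"
  shows "mat_prod n (map (char_matrix (mat\<^sub>h A)) (map hom qs))
       = mat\<^sub>h (mat_prod n (map (char_matrix A) qs))"
proof -
  have "map (char_matrix (mat\<^sub>h A)) (map hom qs) = map mat\<^sub>h (map (char_matrix A) qs)"
    using mat_hom_char_matrix[OF assms] by simp
  also have "mat_prod n \<dots> = mat\<^sub>h (mat_prod n (map (char_matrix A) qs))"
    using assms by (intro mat_hom_mat_prod) auto
  finally show ?thesis .
qed

end

text \<open>
  Over the complex numbers the matrix can be triangularized. As the eigenvalues are rational, the
  resulting annihilating product has rational entries, so it descends to the rational numbers and
  from there to every field of characteristic \<open>0\<close>.
\<close>

lemma rational_eigenvalues_annihilate: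
  fixes A :: "rat mat"
  assumes A: "A \<in> carrier_mat n n"
    and ev: "\<And>z. eigenvalue (map_mat of_rat A :: complex mat) z \<Longrightarrow> z \<in> of_rat ` S"
  obtains qs where "set qs \<subseteq> S"
    "mat_prod n (map (char_matrix (map_mat of_rat A)) (map of_rat qs))
       = (0\<^sub>m n n :: 'k::field_char_0 mat)"
proof -
  let ?A = "map_mat of_rat A :: complex mat"
  have cA: "?A \<in> carrier_mat n n"
    using A by simp
  obtain zs where zs: "char_poly ?A = (\<Prod>z\<leftarrow>zs. [:- z, 1:])"
    using char_poly_factorized[OF cA] by blast
  have "\<forall>z\<in>set zs. \<exists>q\<in>S. z = of_rat q"
  proof
    fix z assume "z \<in> set zs"
    hence "poly (char_poly ?A) z = 0"
      by (auto simp: zs poly_prod_list o_def prod_list_zero_iff)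
    hence "eigenvalue ?A z"
      using eigenvalue_root_char_poly[OF cA] by simp
    thus "\<exists>q\<in>S. z = of_rat q"
      using ev by blast
  qed
  then obtain f where f: "\<And>z. z \<in> set zs \<Longrightarrow> f z \<in> S \<and> z = of_rat (f z)"
    by metis
  define qs where "qs = map f zs"
  have qs: "set qs \<subseteq> S" "map of_rat qs = zs"
    using f by (auto simp: qs_def o_def intro: map_idI)
  obtain T P Q where TPQ: "schur_decomposition ?A zs = (T, P, Q)"
    by (metis prod_cases3)
  have sim: "similar_mat_wit ?A T P Q" and tri: "upper_triangular T" and diag: "diag_mat T = zs"
    using schur_decomposition[OF cA zs TPQ] by auto
  have c: "T \<in> carrier_mat n n" "P \<in> carrier_mat n n" "Q \<in> carrier_mat n n"
    using similar_mat_witD2[OF cA sim] by auto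
  have "mat_prod n (map (char_matrix ?A) zs) = 0\<^sub>m n n"
    unfolding mat_prod_similar[OF cA sim]
    using upper_triangular_annihilated[OF c(1) tri] c by (simp add: diag)
  hence "map_mat (of_rat :: rat \<Rightarrow> complex) (mat_prod n (map (char_matrix A) qs)) = 0\<^sub>m n n"
    unfolding qs(2)[symmetric] of_rat_hom.mat_hom_prod_char_matrix[OF A] .
  also have "\<dots> = map_mat of_rat (0\<^sub>m n n)"
    by (intro eq_matI) auto
  finally have "mat_prod n (map (char_matrix A) qs) = 0\<^sub>m n n"
    by (rule of_rat_hom.mat_hom_inj)
  hence "mat_prod n (map (char_matrix (map_mat of_rat A)) (map of_rat qs))
      = (map_mat of_rat (0\<^sub>m n n) :: 'k mat)"
    by (simp only: of_rat_hom.mat_hom_prod_char_matrix[OF A])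
  also have "\<dots> = 0\<^sub>m n n"
    by (intro eq_matI) auto
  finally show thesis
    using that qs(1) by blast
qed

lemma mat_inv_inverts:
  fixes A :: "'a::field mat"
  assumes A: "A \<in> carrier_mat n n" and "det A \<noteq> 0"
  shows "mat_inv A * A = 1\<^sub>m n" "mat_inv A \<in> carrier_mat n n"
proof -
  have "A \<in> Units (ring_mat TYPE('a) n ())"
    using det_non_zero_imp_unit[OF assms] .
  then obtain B where "mat_inverse A = Some B"
    using mat_inverse(1)[OF A, where b = "()"] by (cases "mat_inverse A") auto
  thus "mat_inv A * A = 1\<^sub>m n" "mat_inv A \<in> carrier_mat n n"
    using mat_inverse(2)[OF A] by (auto simp: mat_inv_def)
qed

lemma det_mat_shift_nonzero:
  fixes A :: "rat mat"
  assumes A: "A \<in> carrier_mat n n"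
    and ev: "\<not> eigenvalue (map_mat of_rat A :: complex mat) (of_int (- k))"
  shows "det (mat_shift (map_mat of_rat A :: 'k::field_char_0 mat) k) \<noteq> 0"
proof -
  have hom: "det (char_matrix (map_mat of_rat A) (of_rat (of_int (- k)))) =
      (of_rat (det (char_matrix A (of_int (- k)))) :: 'b::field_char_0)" for k
    by (simp only: of_rat_hom.mat_hom_char_matrix[OF A] of_rat_hom.hom_det)
  have "det (char_matrix (map_mat of_rat A :: complex mat) (of_rat (of_int (- k)))) \<noteq> 0"
    using ev A eigenvalue_det[of "map_mat of_rat A :: complex mat" n] by (simp add: of_rat_minus)
  hence "det (char_matrix A (of_int (- k))) \<noteq> 0"
    unfolding hom by simp
  hence "det (char_matrix (map_mat of_rat A :: 'k mat) (of_rat (of_int (- k)))) \<noteq> 0"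
    unfolding hom by simp
  also have "char_matrix (map_mat of_rat A :: 'k mat) (of_rat (of_int (- k)))
      = mat_shift (map_mat of_rat A) k"
    by (simp add: char_matrix_def mat_shift_def of_rat_minus)
  finally show ?thesis .
qed

section \<open>Growth of matrix products\<close>

context padic_place
begin

lemma finite_entries: "finite {v (M $$ (i, j)) | i j. i < dim_row M \<and> j < dim_col M}"
proof -
  have "{v (M $$ (i, j)) | i j. i < dim_row M \<and> j < dim_col M}
      = (\<lambda>(i, j). v (M $$ (i, j))) ` ({..<dim_row M} \<times> {..<dim_col M})"
    by auto
  thus ?thesis by simp
qed

lemma entry_le_mat_norm:
  assumes "i < dim_row M" and "j < dim_col M"
  shows "v (M $$ (i, j)) \<le> mat_norm v M"
  unfolding mat_norm_def using assms finite_entries[of M] by (intro Max_ge) auto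

lemma mat_norm_le:
  assumes "0 < dim_row M" and "0 < dim_col M"
    and "\<And>i j. i < dim_row M \<Longrightarrow> j < dim_col M \<Longrightarrow> v (M $$ (i, j)) \<le> B"
  shows "mat_norm v M \<le> B"
  unfolding mat_norm_def using assms finite_entries[of M] by (intro Max.boundedI) auto

lemma mat_norm_nonneg:
  assumes "0 < dim_row M" and "0 < dim_col M"
  shows "0 \<le> mat_norm v M"
  using entry_le_mat_norm[OF assms] v_nonneg order_trans by blast

lemma mat_norm_mult:
  assumes A: "A \<in> carrier_mat m n" and B: "B \<in> carrier_mat n k"
    and pos: "0 < m" "0 < n" "0 < k"
  shows "mat_norm v (A * B) \<le> mat_norm v A * mat_norm v B"
proof (rule mat_norm_le)
  fix i j assume "i < dim_row (A * B)" "j < dim_col (A * B)"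
  hence ij: "i < m" "j < k"
    using A B by auto
  have nn: "0 \<le> mat_norm v A" "0 \<le> mat_norm v B"
    using A B pos by (auto intro: mat_norm_nonneg)
  have "(A * B) $$ (i, j) = (\<Sum>l=0..<n. A $$ (i, l) * B $$ (l, j))"
    using A B ij by (simp add: scalar_prod_def)
  also have "v \<dots> \<le> mat_norm v A * mat_norm v B"
    using A B ij nn
    by (intro v_sum_le) (auto simp: v_mult intro!: mult_mono entry_le_mat_norm)
  finally show "v ((A * B) $$ (i, j)) \<le> mat_norm v A * mat_norm v B" .
qed (use A B pos in auto)

lemma mat_norm_mat_prod:
  assumes "set Ms \<subseteq> carrier_mat n n" and "0 < n"
  shows "mat_norm v (mat_prod n Ms) \<le> (\<Prod>M\<leftarrow>Ms. mat_norm v M)"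
  using assms(1)
proof (induction Ms)
  case Nil
  show ?case
    using assms(2) by (auto intro!: mat_norm_le)
next
  case (Cons M Ms)
  hence M: "M \<in> carrier_mat n n" and Ms: "mat_prod n Ms \<in> carrier_mat n n"
    using mat_prod_carrier[of Ms n] by auto
  have "mat_norm v (M * mat_prod n Ms) \<le> mat_norm v M * mat_norm v (mat_prod n Ms)"
    using mat_norm_mult[OF M Ms] assms(2) by simp
  also have "\<dots> \<le> mat_norm v M * (\<Prod>M\<leftarrow>Ms. mat_norm v M)"
    using Cons M assms(2) by (intro mult_left_mono mat_norm_nonneg) auto
  finally show ?case by simp
qed

text \<open>
  Descent along the partial products \<open>W rs\<close> of the annihilating product. Replacing \<open>L\<close> by an
  eigenvalue \<open>q\<close> in the recurrence for \<open>W rs * G k\<close> leaves the error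
  \<open>W rs * (L - q) * G k\<close>, which belongs to the next partial product. So the growth rate of the
  longer product passes to the shorter one by a scalar recurrence for each entry, and the
  descent starts from \<open>0\<close>.
\<close>

lemma poly_growth_rising_products:
  fixes L :: "'k mat" and G :: "nat \<Rightarrow> 'k mat"
  assumes L: "L \<in> carrier_mat n n" and G: "\<And>k. G k \<in> carrier_mat n n"
    and rec: "\<And>k. G (Suc k) = mat_shift L (int (Suc k)) * G k"
    and qs: "set qs \<subseteq> p_integral_rats p"
    and ann: "mat_prod n (map (char_matrix L) (map of_rat qs)) = 0\<^sub>m n n"
    and "i < n" "j < n"
  shows "poly_growth \<pi> (\<lambda>k. v (G k $$ (i, j)))"
proof -
  define W where "W rs = mat_prod n (map (char_matrix L) (map of_rat rs))" for rs
  have cW: "W rs \<in> carrier_mat n n" for rs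
    using L unfolding W_def by (intro mat_prod_carrier) auto
  have "poly_growth \<pi> (\<lambda>k. v (G k $$ (i, j)))"
    if "set rs \<subseteq> p_integral_rats p"
      and "\<And>i j. i < n \<Longrightarrow> j < n \<Longrightarrow> poly_growth \<pi> (\<lambda>k. v ((W rs * G k) $$ (i, j)))"
    for rs
    using that
  proof (induction rs rule: rev_induct)
    case Nil
    have "W [] * G k = G k" for k
      using G[of k] by (simp add: W_def)
    thus ?case
      using Nil(2)[OF \<open>i < n\<close> \<open>j < n\<close>] by simp
  next
    case (snoc q rs)
    have cL: "char_matrix L (of_rat q) \<in> carrier_mat n n"
      using L by simp
    have Wq: "W (rs @ [q]) = W rs * char_matrix L (of_rat q)"
      using L unfolding W_def by (simp add: mat_prod_snoc image_subset_iff)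
    have step: "W rs * G (Suc k) = W (rs @ [q]) * G k + (of_rat q + of_nat (Suc k)) \<cdot>\<^sub>m (W rs * G k)"
      for k
    proof -
      have "W rs * G (Suc k)
          = W rs * (char_matrix L (of_rat q) * G k + (of_rat q + of_nat (Suc k)) \<cdot>\<^sub>m G k)"
        unfolding rec mat_shift_mult_left[OF L G, of _ _ "of_rat q"] by simp
      also have "\<dots> = W rs * (char_matrix L (of_rat q) * G k)
          + W rs * ((of_rat q + of_nat (Suc k)) \<cdot>\<^sub>m G k)"
        using cW[of rs] cL G[of k] by (intro mult_add_distrib_mat) auto
      also have "W rs * ((of_rat q + of_nat (Suc k)) \<cdot>\<^sub>m G k)
          = (of_rat q + of_nat (Suc k)) \<cdot>\<^sub>m (W rs * G k)"
        using cW G by (rule mult_smult_distrib)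
      also have "W rs * (char_matrix L (of_rat q) * G k) = W (rs @ [q]) * G k"
        unfolding Wq using cW cL G by (intro assoc_mult_mat[symmetric])
      finally show ?thesis .
    qed
    show ?case
    proof (rule snoc.IH)
      fix i j assume ij: "i < n" "j < n"
      have x: "(W rs * G (Suc k)) $$ (i, j)
          = (of_rat q + of_nat (Suc k)) * (W rs * G k) $$ (i, j) + (W (rs @ [q]) * G k) $$ (i, j)"
        for k
        using cW[of rs] cW[of "rs @ [q]"] G[of k] ij unfolding step by simp
      show "poly_growth \<pi> (\<lambda>k. v ((W rs * G k) $$ (i, j)))"
      proof (rule poly_growth_recurrence[OF pi_place_pos])
        show "(\<Prod>k=l..<m. v (of_rat q + of_nat (Suc k))) \<le> real p * (real m + 1) * \<pi> ^ (m - l)"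
          if "l \<le> m" for l m
          using snoc.prems(1) that by (intro prod_shift_le) auto
      qed (use x snoc.prems(2) ij in auto)
    qed (use snoc.prems in simp)
  qed
  moreover have "poly_growth \<pi> (\<lambda>k. v ((W qs * G k) $$ (i, j)))" if "i < n" "j < n" for i j
  proof -
    have "W qs * G k = 0\<^sub>m n n" for k
      using ann G[of k] by (simp add: W_def)
    thus ?thesis
      using that by (simp add: poly_growth_zero)
  qed
  ultimately show ?thesis
    using qs by blast
qed

text \<open>
  The same descent for the inverses. The relation between \<open>H k\<close> and \<open>H (Suc k)\<close> is now implicit,
  so solving it for the new term divides by \<open>q - k\<close>; and since the new factors of \<open>H\<close> appear on
  the right, the partial products are multiplied from the right.
\<close>

lemma poly_growth_inverse_falling_products:
  fixes L :: "'k mat" and H :: "nat \<Rightarrow> 'k mat"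
  assumes L: "L \<in> carrier_mat n n" and H: "\<And>k. H k \<in> carrier_mat n n"
    and rec: "\<And>k. H (Suc k) * mat_shift L (- int k) = H k"
    and qs: "set qs \<subseteq> p_integral_rats p - \<int>"
    and ann: "mat_prod n (map (char_matrix L) (map of_rat qs)) = 0\<^sub>m n n"
    and "i < n" "j < n"
  shows "poly_growth (inverse \<pi>) (\<lambda>k. v (H k $$ (i, j)))"
proof -
  define W where "W rs = mat_prod n (map (char_matrix L) (map of_rat rs))" for rs
  have cW: "W rs \<in> carrier_mat n n" for rs
    using L unfolding W_def by (intro mat_prod_carrier) auto
  have "poly_growth (inverse \<pi>) (\<lambda>k. v (H k $$ (i, j)))"
    if "set rs \<subseteq> p_integral_rats p - \<int>"
      and "\<And>i j. i < n \<Longrightarrow> j < n \<Longrightarrow> poly_growth (inverse \<pi>) (\<lambda>k. v ((H k * W rs) $$ (i, j)))"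
    for rs
    using that
  proof (induction rs)
    case Nil
    have "H k * W [] = H k" for k
      using H[of k] by (simp add: W_def)
    thus ?case
      using Nil(2)[OF \<open>i < n\<close> \<open>j < n\<close>] by simp
  next
    case (Cons q rs)
    have q: "q \<in> p_integral_rats p" "q \<notin> \<int>"
      using Cons.prems(1) by auto
    have cL: "char_matrix L (of_rat q) \<in> carrier_mat n n"
      using L by simp
    have step: "H k * W rs
        = H (Suc k) * W (q # rs) + (of_rat q - of_nat k) \<cdot>\<^sub>m (H (Suc k) * W rs)" for k
    proof -
      have "H k * W rs = H (Suc k) * (mat_shift L (- int k) * W rs)"
        using assoc_mult_mat[OF H[of "Suc k"] mat_shift_carrier[OF L, of "- int k"] cW[of rs]]
        by (simp only: rec)
      also have "\<dots> = H (Suc k) * (W (q # rs) + (of_rat q - of_nat k) \<cdot>\<^sub>m W rs)"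
        unfolding mat_shift_mult_left[OF L cW, of _ _ "of_rat q"] by (simp add: W_def)
      also have "\<dots> = H (Suc k) * W (q # rs) + H (Suc k) * ((of_rat q - of_nat k) \<cdot>\<^sub>m W rs)"
        using cW[of rs] cW[of "q # rs"] H[of "Suc k"] by (intro mult_add_distrib_mat) auto
      also have "H (Suc k) * ((of_rat q - of_nat k) \<cdot>\<^sub>m W rs)
          = (of_rat q - of_nat k) \<cdot>\<^sub>m (H (Suc k) * W rs)"
        using H cW by (rule mult_smult_distrib)
      finally show ?thesis .
    qed
    have nz: "(of_rat q - of_nat k :: 'k) \<noteq> 0" for k
    proof
      assume "(of_rat q - of_nat k :: 'k) = 0"
      hence "(of_rat q :: 'k) = of_rat (of_nat k)" by simp
      hence "q = of_nat k"
        by (simp only: of_rat_eq_iff)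
      thus False
        using q(2) by simp
    qed
    obtain c where c: "1 \<le> c"
      "\<And>m n. m \<le> n \<Longrightarrow>
         (\<Prod>k=m..<n. inverse (v (of_rat q - of_nat k))) \<le> c * (real n + 1) * inverse \<pi> ^ (n - m)"
      using prod_inverse_shift_le[OF q] by blast
    show ?case
    proof (rule Cons.IH)
      fix i j assume ij: "i < n" "j < n"
      let ?x = "\<lambda>k. (H k * W rs) $$ (i, j)" and ?y = "\<lambda>k. (H k * W (q # rs)) $$ (i, j)"
        and ?a = "\<lambda>k. inverse (of_rat q - of_nat k) :: 'k"
      have x: "?x (Suc k) = ?a k * ?x k + ?a k * - ?y (Suc k)" for k
      proof -
        have "?x k = ?y (Suc k) + (of_rat q - of_nat k) * ?x (Suc k)"
          using cW[of rs] cW[of "q # rs"] H[of "Suc k"] ij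
          by (subst step) (simp del: index_mult_mat(1))
        moreover have "x' = inverse a * x + inverse a * - y" if "a \<noteq> 0" "x = y + a * x'"
          for a x x' y :: 'k
          using that by (simp add: field_simps)
        ultimately show ?thesis
          using nz[of k] by blast
      qed
      have "poly_growth (inverse \<pi>) (\<lambda>k. v (?y k))"
        using Cons.prems(2) ij by blast
      hence "poly_growth (inverse \<pi>) (\<lambda>k. 2 * c * inverse \<pi> * (real k + 1) * v (?y (Suc k)))"
        using c(1) pi_place_pos by (intro poly_growth_linear_mult poly_growth_Suc) auto
      hence b: "poly_growth (inverse \<pi>) (\<lambda>k. v (?a k * - ?y (Suc k)))"
      proof (rule poly_growth_mono)
        fix k
        have "v (?a k) \<le> c * (real (Suc k) + 1) * inverse \<pi>"
          using c(2)[of k "Suc k"] by (simp add: v_inverse)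
        also have "\<dots> \<le> c * (2 * (real k + 1)) * inverse \<pi>"
          using c(1) pi_place_pos by (intro mult_right_mono mult_left_mono) auto
        finally have "v (?a k) \<le> 2 * c * inverse \<pi> * (real k + 1)"
          by (simp only: mult_ac)
        thus "v (?a k * - ?y (Suc k)) \<le> 2 * c * inverse \<pi> * (real k + 1) * v (?y (Suc k))"
          unfolding v_mult v_minus by (intro mult_right_mono) auto
      qed
      show "poly_growth (inverse \<pi>) (\<lambda>k. v (?x k))"
      proof (rule poly_growth_recurrence[OF _ _ _ _ b])
        show "0 < inverse \<pi>" "0 \<le> c"
          using pi_place_pos c(1) by auto
        show "?x (Suc k) = ?a k * ?x k + ?a k * - ?y (Suc k)" for k
          by (rule x)
        show "(\<Prod>k=l..<m. v (?a k)) \<le> c * (real m + 1) * inverse \<pi> ^ (m - l)"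
          if "l \<le> m" for l m
          unfolding v_inverse using that by (rule c(2))
      qed
    qed (use Cons.prems in simp)
  qed
  moreover have "poly_growth (inverse \<pi>) (\<lambda>k. v ((H k * W qs) $$ (i, j)))"
    if "i < n" "j < n" for i j
  proof -
    have "H k * W qs = 0\<^sub>m n n" for k
      using ann H[of k] by (simp add: W_def)
    thus ?thesis
      using that by (simp add: poly_growth_zero)
  qed
  ultimately show ?thesis
    using qs by blast
qed

lemma poly_growth_mat_norm:
  assumes "\<And>k. F k \<in> carrier_mat n n" and "0 < n" and "0 \<le> \<rho>"
    and "\<And>i j. i < n \<Longrightarrow> j < n \<Longrightarrow> poly_growth \<rho> (\<lambda>k. v (F k $$ (i, j)))"
  shows "poly_growth \<rho> (\<lambda>k. mat_norm v (F k))"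
proof (rule poly_growth_mono)
  show "poly_growth \<rho> (\<lambda>k. \<Sum>i<n. \<Sum>j<n. v (F k $$ (i, j)))"
    using assms by (intro poly_growth_sum) auto
next
  fix k
  show "mat_norm v (F k) \<le> (\<Sum>i<n. \<Sum>j<n. v (F k $$ (i, j)))"
  proof (rule mat_norm_le)
    fix i j assume "i < dim_row (F k)" "j < dim_col (F k)"
    hence ij: "i < n" "j < n"
      using assms(1)[of k] by auto
    have "v (F k $$ (i, j)) \<le> (\<Sum>j<n. v (F k $$ (i, j)))"
      using ij member_le_sum[of j "{..<n}" "\<lambda>j. v (F k $$ (i, j))"] by simp
    also have "\<dots> \<le> (\<Sum>i<n. \<Sum>j<n. v (F k $$ (i, j)))"
      using ij member_le_sum[of i "{..<n}" "\<lambda>i. \<Sum>j<n. v (F k $$ (i, j))"]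
      by (simp add: sum_nonneg)
    finally show "v (F k $$ (i, j)) \<le> (\<Sum>i<n. \<Sum>j<n. v (F k $$ (i, j)))" .
  qed (use assms(1)[of k] \<open>0 < n\<close> in auto)
qed

lemma mat_norm_smult:
  assumes "0 < dim_row M" and "0 < dim_col M"
  shows "mat_norm v (c \<cdot>\<^sub>m M) \<le> v c * mat_norm v M"
  using assms by (intro mat_norm_le) (auto simp: v_mult intro!: mult_left_mono entry_le_mat_norm)

end

context padic_place
begin

text \<open>
  No eigenvalue is an integer, so all the shifted matrices are invertible and \<open>mat_inv\<close> is a true
  inverse of each of them.
\<close>

lemma poly_growth_C_mat:
  fixes A :: "rat mat" and \<tau> :: 'k
  assumes A: "A \<in> carrier_mat n n" and "0 < n" and "\<tau> \<noteq> 0"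
    and ev: "\<And>z. eigenvalue (map_mat of_rat A :: complex mat) z \<Longrightarrow>
      z \<in> of_rat ` (p_integral_rats p - \<int>)"
  shows "C_mat (map_mat of_rat A) \<tau> k \<in> carrier_mat n n"
    and "poly_growth (\<pi> * inverse (v \<tau>)) (\<lambda>k. mat_norm v (C_mat (map_mat of_rat A) \<tau> (int k)))"
    and "poly_growth (inverse \<pi> * v \<tau>) (\<lambda>k. mat_norm v (C_mat (map_mat of_rat A) \<tau> (- int k)))"
proof -
  define L where "L = (map_mat of_rat A :: 'k mat)"
  define G where "G k = mat_prod n (map (mat_shift L) (rev [1..int k]))" for k
  define H where "H k = mat_prod n (map (\<lambda>l. mat_inv (mat_shift L l)) (rev [1 - int k..0]))" for k
  have L: "L \<in> carrier_mat n n" and dim: "dim_row L = n"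
    using A by (auto simp: L_def)
  have "\<not> eigenvalue (map_mat of_rat A :: complex mat) (of_int (- l))" for l
  proof
    assume "eigenvalue (map_mat of_rat A :: complex mat) (of_int (- l))"
    then obtain q :: rat where q: "complex_of_int (- l) = of_rat q" "q \<notin> \<int>"
      using ev by blast
    hence "(of_rat (of_int (- l)) :: complex) = of_rat q"
      by (simp add: of_rat_minus)
    hence "of_int (- l) = q"
      by (simp only: of_rat_eq_iff)
    thus False
      using q(2) Ints_of_int by blast
  qed
  hence inv: "mat_inv (mat_shift L l) * mat_shift L l = 1\<^sub>m n"
      "mat_inv (mat_shift L l) \<in> carrier_mat n n" for l
    using mat_inv_inverts[OF mat_shift_carrier[OF L]] det_mat_shift_nonzero[OF A]
    unfolding L_def by blast+
  have cG: "G k \<in> carrier_mat n n" for k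
    unfolding G_def using L by (intro mat_prod_carrier) auto
  have cH: "H k \<in> carrier_mat n n" for k
    unfolding H_def using inv by (intro mat_prod_carrier) auto
  have G_Suc: "G (Suc k) = mat_shift L (int (Suc k)) * G k" for k
    by (simp add: G_def upto_rec2 add.commute)
  have H_Suc: "H (Suc k) = H k * mat_inv (mat_shift L (- int k))" for k
  proof -
    have "rev [1 - int (Suc k)..0] = rev [1 - int k..0] @ [- int k]"
      by (simp add: upto_rec1[of "- int k"])
    thus ?thesis
      unfolding H_def using inv by (simp add: mat_prod_snoc image_subset_iff)
  qed
  have H_rec: "H (Suc k) * mat_shift L (- int k) = H k" for k
    using assoc_mult_mat[OF cH[of k] inv(2) mat_shift_carrier[OF L], of "- int k" "- int k"]
      cH[of k] inv(1)[of "- int k"]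
    by (simp add: H_Suc)
  obtain qs where qs: "set qs \<subseteq> p_integral_rats p - \<int>"
    "mat_prod n (map (char_matrix L) (map of_rat qs)) = 0\<^sub>m n n"
    using rational_eigenvalues_annihilate[OF A ev, where 'k = 'k] unfolding L_def by blast
  have qs_integral: "set qs \<subseteq> p_integral_rats p"
    using qs(1) by blast
  have C_pos: "C_mat L \<tau> (int k) = inverse \<tau> ^ k \<cdot>\<^sub>m G k" for k
    using dim L by (cases "k = 0") (auto simp: C_mat_def G_def power_int_def)
  have C_neg: "C_mat L \<tau> (- int k) = \<tau> ^ k \<cdot>\<^sub>m H k" for k
    using dim L by (cases "k = 0") (auto simp: C_mat_def H_def power_int_def add.commute)
  have "k = int (nat k) \<or> k = - int (nat (- k))"
    by linarith
  thus "C_mat (map_mat of_rat A) \<tau> k \<in> carrier_mat n n"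
    using C_pos[of "nat k"] C_neg[of "nat (- k)"] cG cH unfolding L_def
    by (metis smult_carrier_mat)
  have "poly_growth \<pi> (\<lambda>k. mat_norm v (G k))"
    using cG \<open>0 < n\<close> pi_place_pos poly_growth_rising_products[OF L cG G_Suc qs_integral qs(2)]
    by (intro poly_growth_mat_norm) auto
  hence "poly_growth (\<pi> * inverse (v \<tau>)) (\<lambda>k. inverse (v \<tau>) ^ k * mat_norm v (G k))"
    by (intro poly_growth_power_mult) auto
  moreover have "mat_norm v (C_mat L \<tau> (int k)) \<le> inverse (v \<tau>) ^ k * mat_norm v (G k)" for k
    using mat_norm_smult[of "G k" "inverse \<tau> ^ k"] cG[of k] \<open>0 < n\<close>
    unfolding C_pos by (simp add: v_power v_inverse)
  ultimately show "poly_growth (\<pi> * inverse (v \<tau>))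
      (\<lambda>k. mat_norm v (C_mat (map_mat of_rat A) \<tau> (int k)))"
    unfolding L_def by (rule poly_growth_mono)
  have "poly_growth (inverse \<pi>) (\<lambda>k. mat_norm v (H k))"
    using cH \<open>0 < n\<close> pi_place_pos poly_growth_inverse_falling_products[OF L cH H_rec qs]
    by (intro poly_growth_mat_norm) auto
  hence "poly_growth (inverse \<pi> * v \<tau>) (\<lambda>k. v \<tau> ^ k * mat_norm v (H k))"
    by (intro poly_growth_power_mult) auto
  moreover have "mat_norm v (C_mat L \<tau> (- int k)) \<le> v \<tau> ^ k * mat_norm v (H k)" for k
    using mat_norm_smult[of "H k" "\<tau> ^ k"] cH[of k] \<open>0 < n\<close>
    unfolding C_neg by (simp add: v_power)
  ultimately show "poly_growth (inverse \<pi> * v \<tau>)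
      (\<lambda>k. mat_norm v (C_mat (map_mat of_rat A) \<tau> (- int k)))"
    unfolding L_def by (rule poly_growth_mono)
qed

end


section \<open>Growth of families of multi-indices\<close>

lemma poly_growth_prod:
  fixes h :: "nat \<Rightarrow> nat \<Rightarrow> real"
  assumes "0 \<le> \<rho>" and "\<And>i k. i < d \<Longrightarrow> 0 \<le> h i k" and "\<And>i. i < d \<Longrightarrow> poly_growth \<rho> (h i)"
  obtains D e where "0 < D"
    "\<And>k. (\<Prod>i<d. h i (k i)) \<le> D * (real (\<Sum>i<d. k i) + 1) ^ e * \<rho> ^ (\<Sum>i<d. k i)"
proof -
  have "\<exists>D e. 0 < D \<and> (\<forall>k. (\<Prod>i<d. h i (k i))
      \<le> D * (real (\<Sum>i<d. k i) + 1) ^ e * \<rho> ^ (\<Sum>i<d. k i))"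
    using assms(2,3)
  proof (induction d)
    case 0
    show ?case
      by (intro exI[of _ 1] exI[of _ 0]) simp
  next
    case (Suc d)
    then obtain D e where D: "0 < D"
      "\<And>k. (\<Prod>i<d. h i (k i)) \<le> D * (real (\<Sum>i<d. k i) + 1) ^ e * \<rho> ^ (\<Sum>i<d. k i)"
      by force
    obtain C e' where C: "0 \<le> C" "\<And>k. h d k \<le> C * (real k + 1) ^ e' * \<rho> ^ k"
      using poly_growthE[OF Suc.prems(2)[of d]] by blast
    have "(\<Prod>i<Suc d. h i (k i))
        \<le> (D * (C + 1)) * (real (\<Sum>i<Suc d. k i) + 1) ^ (e + e') * \<rho> ^ (\<Sum>i<Suc d. k i)" for k
    proof -
      define s where "s = (\<Sum>i<d. k i)"
      have "(\<Prod>i<d. h i (k i)) \<le> D * (real s + 1) ^ e * \<rho> ^ s"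
        unfolding s_def by (rule D(2))
      hence "(\<Prod>i<Suc d. h i (k i))
          \<le> (D * (real s + 1) ^ e * \<rho> ^ s) * (C * (real (k d) + 1) ^ e' * \<rho> ^ k d)"
        using D(1) C Suc.prems(1) \<open>0 \<le> \<rho>\<close> unfolding prod.lessThan_Suc
        by (intro mult_mono mult_nonneg_nonneg) auto
      also have "\<dots> \<le> (D * (real (s + k d) + 1) ^ e * \<rho> ^ s)
          * ((C + 1) * (real (s + k d) + 1) ^ e' * \<rho> ^ k d)"
        using D(1) C(1) \<open>0 \<le> \<rho>\<close>
        by (intro mult_mono mult_right_mono mult_left_mono power_mono) auto
      also have "\<dots> = (D * (C + 1)) * (real (s + k d) + 1) ^ (e + e') * \<rho> ^ (s + k d)"
        by (simp only: power_add mult_ac)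
      finally show ?thesis
        by (simp add: s_def)
    qed
    moreover have "0 < D * (C + 1)"
      using D(1) C(1) by simp
    ultimately show ?case by blast
  qed
  with that show thesis by blast
qed

lemma eventually_index_filter:
  "eventually P (index_filter d) \<longleftrightarrow>
     (\<exists>N. \<forall>\<alpha>\<in>nat_indices d. N \<le> abs_index \<alpha> \<longrightarrow> P \<alpha>)"
  unfolding index_filter_def eventually_inf_principal eventually_filtercomap
    eventually_at_top_linorder
  by auto

text \<open>
  Polynomial factors disappear in the \<open>|\<alpha>|\<close>-th root: they are eventually below \<open>c ^ |\<alpha>|\<close>
  for each \<open>c > 1\<close>, and \<open>c\<close> tends to \<open>1\<close> at the end.
\<close>

lemma growth_le_mult:
  assumes "0 < \<rho>" and "0 < D"
    and nn: "\<And>\<alpha>. \<alpha> \<in> nat_indices d \<Longrightarrow> 0 \<le> mat_norm v (E \<alpha>) \<and> 0 \<le> mat_norm v (F \<alpha>)"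
    and le: "\<And>\<alpha>. \<alpha> \<in> nat_indices d \<Longrightarrow> mat_norm v (F \<alpha>) \<le>
      mat_norm v (E \<alpha>) * (D * (real_of_int (abs_index \<alpha>) + 1) ^ e * \<rho> ^ nat (abs_index \<alpha>))"
  shows "growth d v F \<le> ereal \<rho> * growth d v E"
proof (cases "index_filter d = bot")
  case True
  thus ?thesis
    by (simp add: growth_def)
next
  case False
  have bound: "growth d v F \<le> ereal (c * \<rho>) * growth d v E" if "1 < c" for c
  proof -
    have "((\<lambda>x::real. D powr (1 / x) * ((x + 1) powr (1 / x)) ^ e) \<longlongrightarrow> 1 * 1 ^ e) at_top"
      using \<open>0 < D\<close> by (intro tendsto_intros tendsto_power) real_asymp+
    hence "eventually (\<lambda>x::real. D powr (1 / x) * ((x + 1) powr (1 / x)) ^ e < c) at_top"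
      using that by (intro order_tendstoD(2)) auto
    then obtain X where X: "\<And>x::real. X \<le> x \<Longrightarrow> D powr (1 / x) * ((x + 1) powr (1 / x)) ^ e < c"
      unfolding eventually_at_top_linorder by blast
    have "eventually (\<lambda>\<alpha>. ereal (mat_norm v (F \<alpha>) powr (1 / real_of_int (abs_index \<alpha>)))
        \<le> ereal (c * \<rho>) * ereal (mat_norm v (E \<alpha>) powr (1 / real_of_int (abs_index \<alpha>))))
        (index_filter d)"
      unfolding eventually_index_filter
    proof (intro exI[of _ "max 1 \<lceil>X\<rceil>"] ballI impI)
      fix \<alpha> assume \<alpha>: "\<alpha> \<in> nat_indices d" "max 1 \<lceil>X\<rceil> \<le> abs_index \<alpha>"
      define x where "x = real_of_int (abs_index \<alpha>)"
      have x: "1 \<le> x" "X \<le> x"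
        using \<alpha>(2) by (auto simp: x_def ceiling_le_iff)
      have "\<rho> ^ nat (abs_index \<alpha>) = \<rho> powr x"
        using \<open>0 < \<rho>\<close> \<alpha>(2) by (simp add: x_def flip: powr_realpow)
      hence "mat_norm v (F \<alpha>) \<le> mat_norm v (E \<alpha>) * (D * (x + 1) ^ e * \<rho> powr x)"
        using le[OF \<alpha>(1)] by (simp add: x_def)
      hence "mat_norm v (F \<alpha>) powr (1 / x)
          \<le> (mat_norm v (E \<alpha>) * (D * (x + 1) ^ e * \<rho> powr x)) powr (1 / x)"
        using nn[OF \<alpha>(1)] x(1) by (intro powr_mono2) auto
      also have "\<dots> = mat_norm v (E \<alpha>) powr (1 / x)
          * (D powr (1 / x) * ((x + 1) powr (1 / x)) ^ e) * \<rho>"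
      proof -
        have "((x + 1) ^ e) powr (1 / x) = ((x + 1) powr (1 / x)) ^ e"
          using x(1) by (simp add: powr_powr mult.commute flip: powr_realpow powr_power)
        moreover have "(\<rho> powr x) powr (1 / x) = \<rho>"
          using x(1) \<open>0 < \<rho>\<close> by (simp add: powr_powr)
        ultimately show ?thesis
          using nn[OF \<alpha>(1)] x(1) \<open>0 < D\<close> \<open>0 < \<rho>\<close> by (simp add: powr_mult)
      qed
      also have "\<dots> \<le> mat_norm v (E \<alpha>) powr (1 / x) * c * \<rho>"
        using X[OF x(2)] \<open>0 < \<rho>\<close> by (intro mult_right_mono mult_left_mono) auto
      finally show "ereal (mat_norm v (F \<alpha>) powr (1 / real_of_int (abs_index \<alpha>)))
          \<le> ereal (c * \<rho>) * ereal (mat_norm v (E \<alpha>) powr (1 / real_of_int (abs_index \<alpha>)))"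
        by (simp add: x_def mult_ac)
    qed
    hence "growth d v F \<le> Limsup (index_filter d)
        (\<lambda>\<alpha>. ereal (c * \<rho>) * ereal (mat_norm v (E \<alpha>) powr (1 / real_of_int (abs_index \<alpha>))))"
      unfolding growth_def by (rule Limsup_mono)
    also have "\<dots> = ereal (c * \<rho>) * growth d v E"
      unfolding growth_def using False that \<open>0 < \<rho>\<close> by (intro Limsup_ereal_mult_left) auto
    finally show ?thesis .
  qed
  show ?thesis
  proof (cases "growth d v E")
    case (real g)
    have "((\<lambda>c. ereal (c * \<rho> * g)) \<longlongrightarrow> ereal (1 * \<rho> * g)) (at_right (1::real))"
      by (intro tendsto_intros)
    moreover have "eventually (\<lambda>c. growth d v F \<le> ereal (c * \<rho> * g)) (at_right (1::real))"
      using eventually_at_right_less[of "1::real"]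
      by eventually_elim (use bound real in auto)
    ultimately have "growth d v F \<le> ereal (1 * \<rho> * g)"
      by (intro tendsto_lowerbound) auto
    thus ?thesis
      by (simp add: real)
  next
    case PInf
    thus ?thesis
      using \<open>0 < \<rho>\<close> by simp
  next
    case MInf
    thus ?thesis
      using bound[of 2] \<open>0 < \<rho>\<close> by simp
  qed
qed

context padic_place
begin

text \<open>
  Both halves of the theorem are instances, with \<open>B i k\<close> one of the two branches of \<open>C_mat\<close>. Growth
  in each single index suffices, since the norm is submultiplicative and the exponents of the
  common rate \<open>\<rho>\<close> add up to \<open>|\<alpha>|\<close>.
\<close>

lemma growth_mult_mat_prod:
  fixes E :: "int vec \<Rightarrow> 'k mat" and B :: "nat \<Rightarrow> nat \<Rightarrow> 'k mat"
  assumes "0 < \<rho>" and "0 < m" and "0 < n"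
    and E: "\<And>\<alpha>. \<alpha> \<in> nat_indices d \<Longrightarrow> E \<alpha> \<in> carrier_mat m n"
    and B: "\<And>i k. i < d \<Longrightarrow> B i k \<in> carrier_mat n n"
    and growth: "\<And>i. i < d \<Longrightarrow> poly_growth \<rho> (\<lambda>k. mat_norm v (B i k))"
    and F: "\<And>\<alpha>. \<alpha> \<in> nat_indices d \<Longrightarrow>
      F \<alpha> = E \<alpha> * mat_prod n (map (\<lambda>i. B i (nat (\<alpha> $ i))) [0..<d])"
  shows "growth d v F \<le> ereal \<rho> * growth d v E"
proof -
  have nnB: "0 \<le> mat_norm v (B i k)" if "i < d" for i k
    using B[OF that, of k] \<open>0 < n\<close> by (intro mat_norm_nonneg) auto
  obtain D e where D: "0 < D"
    "\<And>k. (\<Prod>i<d. mat_norm v (B i (k i)))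
      \<le> D * (real (\<Sum>i<d. k i) + 1) ^ e * \<rho> ^ (\<Sum>i<d. k i)"
    using poly_growth_prod[of \<rho> d "\<lambda>i k. mat_norm v (B i k)"] nnB growth \<open>0 < \<rho>\<close> by auto
  show ?thesis
  proof (rule growth_le_mult[OF \<open>0 < \<rho>\<close> D(1)])
    fix \<alpha> assume \<alpha>: "\<alpha> \<in> nat_indices d"
    define P where "P = mat_prod n (map (\<lambda>i. B i (nat (\<alpha> $ i))) [0..<d])"
    have setB: "set (map (\<lambda>i. B i (nat (\<alpha> $ i))) [0..<d]) \<subseteq> carrier_mat n n"
      using B by auto
    have P: "P \<in> carrier_mat n n"
      unfolding P_def by (rule mat_prod_carrier[OF setB])
    show nn: "0 \<le> mat_norm v (E \<alpha>) \<and> 0 \<le> mat_norm v (F \<alpha>)"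
      using E[OF \<alpha>] P \<open>0 < m\<close> \<open>0 < n\<close> unfolding F[OF \<alpha>] P_def[symmetric]
      by (auto intro!: mat_norm_nonneg)
    have abs: "int (\<Sum>i<d. nat (\<alpha> $ i)) = abs_index \<alpha>"
      using \<alpha> by (auto simp: abs_index_def nat_indices_def intro!: sum.cong)
    have "mat_norm v P \<le> (\<Prod>M\<leftarrow>map (\<lambda>i. B i (nat (\<alpha> $ i))) [0..<d]. mat_norm v M)"
      unfolding P_def by (rule mat_norm_mat_prod[OF setB \<open>0 < n\<close>])
    also have "\<dots> = (\<Prod>i<d. mat_norm v (B i (nat (\<alpha> $ i))))"
      by (simp add: o_def prod.list_conv_set_nth atLeast0LessThan)
    also have "\<dots> \<le> D * (real (\<Sum>i<d. nat (\<alpha> $ i)) + 1) ^ e * \<rho> ^ (\<Sum>i<d. nat (\<alpha> $ i))"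
      by (rule D(2))
    also have "real (\<Sum>i<d. nat (\<alpha> $ i)) = real_of_int (abs_index \<alpha>)"
      unfolding abs[symmetric] by (rule of_int_of_nat_eq[symmetric])
    also have "(\<Sum>i<d. nat (\<alpha> $ i)) = nat (abs_index \<alpha>)"
      unfolding abs[symmetric] by (rule nat_int[symmetric])
    finally have norm_P: "mat_norm v P
        \<le> D * (real_of_int (abs_index \<alpha>) + 1) ^ e * \<rho> ^ nat (abs_index \<alpha>)" .
    have "mat_norm v (F \<alpha>) \<le> mat_norm v (E \<alpha>) * mat_norm v P"
      unfolding F[OF \<alpha>] P_def[symmetric]
      using mat_norm_mult[OF E[OF \<alpha>] P] \<open>0 < m\<close> \<open>0 < n\<close> by simp
    also have "\<dots> \<le> mat_norm v (E \<alpha>)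
        * (D * (real_of_int (abs_index \<alpha>) + 1) ^ e * \<rho> ^ nat (abs_index \<alpha>))"
      using norm_P nn by (intro mult_left_mono) auto
    finally show "mat_norm v (F \<alpha>) \<le> mat_norm v (E \<alpha>)
        * (D * (real_of_int (abs_index \<alpha>) + 1) ^ e * \<rho> ^ nat (abs_index \<alpha>))" .
  qed
qed

end

theorem proposition4p7:
  fixes d \<nu> \<mu> p :: nat
    and v :: "'k::field_char_0 \<Rightarrow> real"
    and \<Lambda> :: "nat \<Rightarrow> rat mat"
    and \<tau> :: 'k
    and \<tau>s :: "nat \<Rightarrow> 'k"
    and Y :: "int vec \<Rightarrow> 'k mat"
  assumes "number_field TYPE('k)"
    and "finite_place_above p v"
    and "d \<ge> 1" and "\<nu> \<ge> 1" and "\<mu> \<ge> 1"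
    and "\<And>i. i < d \<Longrightarrow> \<Lambda> i \<in> carrier_mat \<nu> \<nu> \<and> invertible_mat (\<Lambda> i)"
    and "\<And>i j. i < d \<Longrightarrow> j < d \<Longrightarrow> \<Lambda> i * \<Lambda> j = \<Lambda> j * \<Lambda> i"
    and "\<And>i z. i < d \<Longrightarrow> eigenvalue (map_mat of_rat (\<Lambda> i) :: complex mat) z \<Longrightarrow>
           z \<in> of_rat ` (p_integral_rats p - \<int>)"
    and "\<tau> \<noteq> 0"
    and "\<And>i. i < d \<Longrightarrow> \<tau>s i = \<tau>"
    and "\<And>\<alpha>. \<alpha> \<in> nat_indices d \<union> neg_indices d \<Longrightarrow> Y \<alpha> \<in> carrier_mat \<mu> \<nu>"
  shows "let Z = Z_coeff d \<nu> \<tau>s (\<lambda>i. map_mat of_rat (\<Lambda> i)) Y in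
      growth d v Z \<le> ereal (inverse (pi_place p v) * v \<tau>) * growth d v (\<lambda>\<alpha>. Y (- \<alpha>)) \<and>
      growth d v (\<lambda>\<alpha>. Z (- \<alpha>)) \<le> ereal (pi_place p v * inverse (v \<tau>)) * growth d v Y"
proof -
  interpret padic_place p v
    by unfold_locales fact
  let ?L = "\<lambda>i. map_mat of_rat (\<Lambda> i) :: 'k mat"
  let ?Z = "Z_coeff d \<nu> \<tau>s ?L Y"
  have "0 < \<nu>" "0 < \<mu>"
    using assms(4,5) by auto
  have v\<tau>: "0 < v \<tau>"
    using v_pos[OF \<open>\<tau> \<noteq> 0\<close>] .
  have C: "C_mat (?L i) \<tau> k \<in> carrier_mat \<nu> \<nu>"
      "poly_growth (pi_place p v * inverse (v \<tau>)) (\<lambda>k. mat_norm v (C_mat (?L i) \<tau> (int k)))"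
      "poly_growth (inverse (pi_place p v) * v \<tau>) (\<lambda>k. mat_norm v (C_mat (?L i) \<tau> (- int k)))"
    if "i < d" for i k
    using poly_growth_C_mat[of "\<Lambda> i" \<nu> \<tau>] assms(6)[OF that] assms(8)[OF that] \<open>0 < \<nu>\<close> \<open>\<tau> \<noteq> 0\<close>
    by blast+
  have idx: "- \<alpha> \<in> neg_indices d" "\<alpha> \<in> carrier_vec d" "\<And>i. i < d \<Longrightarrow> 0 \<le> \<alpha> $ i"
    if "\<alpha> \<in> nat_indices d" for \<alpha>
    using that by (auto simp: nat_indices_def neg_indices_def)
  have "growth d v ?Z \<le> ereal (inverse (pi_place p v) * v \<tau>) * growth d v (\<lambda>\<alpha>. Y (- \<alpha>))"
  proof (rule growth_mult_mat_prod[where m = \<mu> and n = \<nu>])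
    show "?Z \<alpha> = Y (- \<alpha>) * mat_prod \<nu> (map (\<lambda>i. C_mat (?L i) \<tau> (- int (nat (\<alpha> $ i)))) [0..<d])"
      if "\<alpha> \<in> nat_indices d" for \<alpha>
    proof -
      have "map (\<lambda>i. C_mat (?L i) (\<tau>s i) (- (\<alpha> $ i))) [0..<d]
          = map (\<lambda>i. C_mat (?L i) \<tau> (- int (nat (\<alpha> $ i)))) [0..<d]"
        using idx[OF that] assms(10) by (intro map_cong) auto
      thus ?thesis
        by (simp only: Z_coeff_def)
    qed
  qed (use C assms(11) idx pi_place_pos v\<tau> \<open>0 < \<nu>\<close> \<open>0 < \<mu>\<close> in auto)
  moreover have "growth d v (\<lambda>\<alpha>. ?Z (- \<alpha>))
      \<le> ereal (pi_place p v * inverse (v \<tau>)) * growth d v Y"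
  proof (rule growth_mult_mat_prod[where m = \<mu> and n = \<nu>])
    show "?Z (- \<alpha>) = Y \<alpha> * mat_prod \<nu> (map (\<lambda>i. C_mat (?L i) \<tau> (int (nat (\<alpha> $ i)))) [0..<d])"
      if "\<alpha> \<in> nat_indices d" for \<alpha>
    proof -
      have "map (\<lambda>i. C_mat (?L i) (\<tau>s i) (- ((- \<alpha>) $ i))) [0..<d]
          = map (\<lambda>i. C_mat (?L i) \<tau> (int (nat (\<alpha> $ i)))) [0..<d]"
        using idx[OF that] assms(10) by (intro map_cong) auto
      moreover have "- (- \<alpha>) = \<alpha>"
        using idx(2)[OF that] by simp
      ultimately show ?thesis
        by (simp only: Z_coeff_def)
    qed
  qed (use C assms(11) idx pi_place_pos v\<tau> \<open>0 < \<nu>\<close> \<open>0 < \<mu>\<close> in auto)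
  ultimately show ?thesis
    by (simp add: Let_def)
qed

end
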